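(* There exists a finite set $\Sigma$ of dependencies that is both linear and sticky such that repair checking for $\Sigma$ is PTIME-hard with respect to data complexity, i.e. the problem of deciding, given databases $\mathcal{D}$ and $\mathcal{D}'$, whether $\mathcal{D}'$ is a repair of $\langle\Sigma,\mathcal{D}\rangle$ is PTIME-hard.
   Context: A signature is a set of predicate symbols with arities, always containing a special 0-ary predicate $\bot$. A term is a constant or a variable; a (predicate) atom is $p(t_1,\dots,t_n)$ with $p$ of arity $n$; an inequality is $t\neq t'$. A database is a finite set of ground atoms (facts) not containing $\bot$. A conjunction with inequalities is a conjunction of at least one predicate atom or inequality. A conjunctive query (CQ) is $\exists\vec y\,\gamma$ with $\gamma$ a conjunction with inequalities; a union of CQs (UCQ) is a finite disjunction of CQs. A dependency is a first-order sentence $\forall\vec x\,(\gamma\rightarrow Q)$ where $\gamma$ (the body) is a conjunction with inequalities all of whose variables are in $\vec x$ and each occurs in some predicate atom of $\gamma$, and $Q$ (the head) is a UCQ whose free variables are among $\vec x$ and in which every existentially quantified variable of each disjunct occurs in a predicate atom of that disjunct. A database $\mathcal{D}$ is consistent with a finite set $\Sigma$ of dependencies if $\mathcal{D}$ (evaluated as a finite relational structure, formulas being domain-independent) satisfies every dependency of $\Sigma$. A repair of $\langle\Sigma,\mathcal{D}\rangle$ is a subset of $\mathcal{D}$ that is consistent with $\Sigma$ and maximal with respect to set inclusion among such subsets. Data complexity: $\Sigma$ is fixed and only the databases are the input. A dependency is linear if its body contains exactly one predicate atom. Stickiness: assume distinct dependencies use distinct variables; the marked variables are defined inductively: a variable $x$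 occurring in the body of $\tau\in\Sigma$ is marked if (i) some atom of the head of $\tau$ does not contain $x$, or (ii) there are a dependency $\tau'\in\Sigma$ and a predicate $p$ such that the head of $\tau$ contains $p(\vec t)$, the body of $\tau'$ contains $p(\vec t')$, and whenever $x$ is the $i$-th term of $\vec t$, the $i$-th term of $\vec t'$ is a marked variable. $\Sigma$ is sticky if, for every $\tau\in\Sigma$, every marked variable occurs at most once in the body of $\tau$. *)

theory Defs
  imports Complex_Main
begin

section \<open>Machine model: Turing machines with a read-only input tape,
  one work tape and a write-only one-way output tape\<close>

datatype move = MvL | MvS | MvR
datatype isym = LEnd | REnd | Bit bool

record tm =
  states :: "nat set"
  syms   :: "nat set"      \<comment> \<open>work-tape alphabet; 0 is the blank\<close>
  start  :: nat
  acc    :: nat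
  rej    :: nat
  delta  :: "nat \<Rightarrow> isym \<Rightarrow> nat \<Rightarrow> nat \<times> nat \<times> move \<times> move \<times> bool option"
            \<comment> \<open>(new state, written work symbol, input-head move, work-head move, output)\<close>

record config =
  cst   :: nat
  ipos  :: nat
  wpos  :: nat
  wtape :: "nat \<Rightarrow> nat"
  out   :: "bool list"

definition wf_tm :: "tm \<Rightarrow> bool" where
  "wf_tm M \<longleftrightarrow> finite (states M) \<and> finite (syms M) \<and> 0 \<in> syms M \<and>
     start M \<in> states M \<and> acc M \<in> states M \<and> rej M \<in> states M \<and> acc M \<noteq> rej M \<and>
     (\<forall>q\<in>states M. \<forall>a s. s \<in> syms M \<longrightarrow>
        (case delta M q a s of (q', s', _, _, _) \<Rightarrow> q' \<in> states M \<and> s' \<in> syms M))"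

definition input_sym :: "bool list \<Rightarrow> nat \<Rightarrow> isym" where
  "input_sym w i = (if i = 0 then LEnd else if i \<le> length w then Bit (w ! (i - 1)) else REnd)"

fun mv :: "move \<Rightarrow> nat \<Rightarrow> nat" where
  "mv MvL i = i - 1"
| "mv MvS i = i"
| "mv MvR i = Suc i"

definition halted :: "tm \<Rightarrow> config \<Rightarrow> bool" where
  "halted M c \<longleftrightarrow> cst c = acc M \<or> cst c = rej M"

definition step :: "tm \<Rightarrow> bool list \<Rightarrow> config \<Rightarrow> config" where
  "step M w c = (if halted M c then c else
     (case delta M (cst c) (input_sym w (ipos c)) (wtape c (wpos c)) of
        (q', s', mi, mw, ob) \<Rightarrow>
          c\<lparr>cst := q', ipos := min (Suc (length w)) (mv mi (ipos c)),
             wpos := mv mw (wpos c), wtape := (wtape c)(wpos c := s'),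
             out := out c @ (case ob of None \<Rightarrow> [] | Some b \<Rightarrow> [b])\<rparr>))"

definition init :: "tm \<Rightarrow> config" where
  "init M = \<lparr>cst = start M, ipos = 0, wpos = 0, wtape = (\<lambda>_. 0), out = []\<rparr>"

definition run :: "tm \<Rightarrow> bool list \<Rightarrow> nat \<Rightarrow> config" where
  "run M w n = (step M w ^^ n) (init M)"

definition PTIME :: "bool list set set" where
  "PTIME = {L. \<exists>M k. wf_tm M \<and> (\<forall>w. \<exists>n. n \<le> k * (length w + 1) ^ k \<and>
      halted M (run M w n) \<and> (cst (run M w n) = acc M \<longleftrightarrow> w \<in> L))}"

definition logspace_computes :: "tm \<Rightarrow> (bool list \<Rightarrow> bool list) \<Rightarrow> bool" where
  "logspace_computes M f \<longleftrightarrow> wf_tm M \<and> (\<exists>k::nat. \<forall>w. \<exists>n.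
      halted M (run M w n) \<and> out (run M w n) = f w \<and>
      (\<forall>m\<le>n. real (wpos (run M w m)) \<le> real k * log 2 (real (length w + 2))))"

definition logspace_reducible :: "bool list set \<Rightarrow> bool list set \<Rightarrow> bool" where
  "logspace_reducible L1 L2 \<longleftrightarrow>
     (\<exists>M f. logspace_computes M f \<and> (\<forall>w. w \<in> L1 \<longleftrightarrow> f w \<in> L2))"

definition ptime_hard :: "bool list set \<Rightarrow> bool" where
  "ptime_hard L \<longleftrightarrow> (\<forall>L'. L' \<in> PTIME \<longrightarrow> logspace_reducible L' L)"

datatype pred = Bot | P nat nat

fun arity :: "pred \<Rightarrow> nat" where
  "arity Bot = 0"
| "arity (P a k) = k"

datatype trm = Cst nat | Var nat
datatype lit = Atom pred "trm list" | Neq trm trm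

type_synonym conj = "lit list"
type_synonym cq = "nat list \<times> conj"         \<comment> \<open>existential variables, conjunction\<close>
type_synonym dep = "conj \<times> cq list"        \<comment> \<open>body, head (a UCQ)\<close>
type_synonym fact = "pred \<times> nat list"

fun vars_trm :: "trm \<Rightarrow> nat set" where
  "vars_trm (Cst c) = {}"
| "vars_trm (Var x) = {x}"

fun vars_lit :: "lit \<Rightarrow> nat set" where
  "vars_lit (Atom p ts) = (\<Union>t\<in>set ts. vars_trm t)"
| "vars_lit (Neq s t) = vars_trm s \<union> vars_trm t"

fun is_atom :: "lit \<Rightarrow> bool" where
  "is_atom (Atom p ts) = True"
| "is_atom (Neq s t) = False"

definition vars_conj :: "conj \<Rightarrow> nat set" where
  "vars_conj g = (\<Union>l\<in>set g. vars_lit l)"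

definition atom_vars :: "conj \<Rightarrow> nat set" where
  "atom_vars g = (\<Union>l\<in>set (filter is_atom g). vars_lit l)"

fun wf_lit :: "pred set \<Rightarrow> lit \<Rightarrow> bool" where
  "wf_lit S (Atom p ts) \<longleftrightarrow> p \<in> S \<and> length ts = arity p"
| "wf_lit S (Neq s t) \<longleftrightarrow> True"

definition wf_conj :: "pred set \<Rightarrow> conj \<Rightarrow> bool" where
  "wf_conj S g \<longleftrightarrow> g \<noteq> [] \<and> (\<forall>l\<in>set g. wf_lit S l)"

text \<open>A dependency over signature \<open>S\<close>: universally quantified variables are those of the body.\<close>
definition wf_dep :: "pred set \<Rightarrow> dep \<Rightarrow> bool" where
  "wf_dep S d \<longleftrightarrow> (case d of (body, head) \<Rightarrow>
     wf_conj S body \<and> vars_conj body \<subseteq> atom_vars body \<and> head \<noteq> [] \<and>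
     (\<forall>(ys, g)\<in>set head. wf_conj S g \<and> set ys \<subseteq> atom_vars g \<and>
        vars_conj g - set ys \<subseteq> vars_conj body))"

fun eval_trm :: "(nat \<Rightarrow> nat) \<Rightarrow> trm \<Rightarrow> nat" where
  "eval_trm h (Cst c) = c"
| "eval_trm h (Var x) = h x"

fun sat_lit :: "fact set \<Rightarrow> (nat \<Rightarrow> nat) \<Rightarrow> lit \<Rightarrow> bool" where
  "sat_lit D h (Atom p ts) \<longleftrightarrow> (p, map (eval_trm h) ts) \<in> D"
| "sat_lit D h (Neq s t) \<longleftrightarrow> eval_trm h s \<noteq> eval_trm h t"

definition sat_conj :: "fact set \<Rightarrow> (nat \<Rightarrow> nat) \<Rightarrow> conj \<Rightarrow> bool" where
  "sat_conj D h g \<longleftrightarrow> (\<forall>l\<in>set g. sat_lit D h l)"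

definition sat_cq :: "fact set \<Rightarrow> (nat \<Rightarrow> nat) \<Rightarrow> cq \<Rightarrow> bool" where
  "sat_cq D h q \<longleftrightarrow> (case q of (ys, g) \<Rightarrow>
     \<exists>h'. (\<forall>x. x \<notin> set ys \<longrightarrow> h' x = h x) \<and> sat_conj D h' g)"

definition satisfies :: "fact set \<Rightarrow> dep \<Rightarrow> bool" where
  "satisfies D d \<longleftrightarrow> (case d of (body, head) \<Rightarrow>
     \<forall>h. sat_conj D h body \<longrightarrow> (\<exists>q\<in>set head. sat_cq D h q))"

definition consistent :: "dep set \<Rightarrow> fact set \<Rightarrow> bool" where
  "consistent Sig D \<longleftrightarrow> (\<forall>d\<in>Sig. satisfies D d)"

definition is_db :: "pred set \<Rightarrow> fact set \<Rightarrow> bool" where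
  "is_db S D \<longleftrightarrow> finite D \<and> (\<forall>(p, cs)\<in>D. p \<in> S \<and> p \<noteq> Bot \<and> length cs = arity p)"

definition is_repair :: "dep set \<Rightarrow> fact set \<Rightarrow> fact set \<Rightarrow> bool" where
  "is_repair Sig D D' \<longleftrightarrow> D' \<subseteq> D \<and> consistent Sig D' \<and>
     (\<forall>D''. D' \<subset> D'' \<and> D'' \<subseteq> D \<longrightarrow> \<not> consistent Sig D'')"

definition linear_deps :: "dep set \<Rightarrow> bool" where
  "linear_deps Sig \<longleftrightarrow> (\<forall>d\<in>Sig. length (filter is_atom (fst d)) = 1)"

text \<open>Marked variables, renamed apart by pairing each variable with its dependency.
  A head occurrence of \<open>x\<close> counts only if it is free (not existentially bound).\<close>
inductive marked :: "dep set \<Rightarrow> dep \<Rightarrow> nat \<Rightarrow> bool" for Sig where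
  mark_base: "\<lbrakk> d \<in> Sig; x \<in> vars_conj (fst d); (ys, g) \<in> set (snd d); Atom p ts \<in> set g;
               \<not> (Var x \<in> set ts \<and> x \<notin> set ys) \<rbrakk> \<Longrightarrow> marked Sig d x"
| mark_prop: "\<lbrakk> d \<in> Sig; x \<in> vars_conj (fst d); (ys, g) \<in> set (snd d); Atom p ts \<in> set g;
               d' \<in> Sig; Atom p ts' \<in> set (fst d');
               \<forall>i < length ts. ts ! i = Var x \<and> x \<notin> set ys \<longrightarrow>
                  (\<exists>y. ts' ! i = Var y \<and> marked Sig d' y) \<rbrakk> \<Longrightarrow> marked Sig d x"

fun occ_lit :: "nat \<Rightarrow> lit \<Rightarrow> nat" where
  "occ_lit x (Atom p ts) = count_list ts (Var x)"
| "occ_lit x (Neq s t) = (if s = Var x then 1 else 0) + (if t = Var x then 1 else 0)"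

definition occ :: "nat \<Rightarrow> conj \<Rightarrow> nat" where
  "occ x g = sum_list (map (occ_lit x) g)"

definition sticky :: "dep set \<Rightarrow> bool" where
  "sticky Sig \<longleftrightarrow> (\<forall>d\<in>Sig. \<forall>x. marked Sig d x \<longrightarrow> occ x (fst d) \<le> 1)"

datatype tok = T0 | T1 | TSep | TEnd

fun tok_bits :: "tok \<Rightarrow> bool list" where
  "tok_bits T0 = [False, False]"
| "tok_bits T1 = [False, True]"
| "tok_bits TSep = [True, False]"
| "tok_bits TEnd = [True, True]"

fun bin :: "nat \<Rightarrow> tok list" where
  "bin n = (if n = 0 then [] else (if odd n then T1 else T0) # bin (n div 2))"

fun enc_fact :: "fact \<Rightarrow> tok list" where
  "enc_fact (Bot, cs) = [TEnd]"
| "enc_fact (P a k, cs) = bin a @ [TSep] @ bin k @ concat (map (\<lambda>c. TSep # bin c) cs) @ [TEnd]"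

definition enc_db :: "fact list \<Rightarrow> tok list" where
  "enc_db fs = concat (map enc_fact fs) @ [TEnd]"

definition enc_pair :: "fact list \<Rightarrow> fact list \<Rightarrow> bool list" where
  "enc_pair fs gs = concat (map tok_bits (enc_db fs @ enc_db gs))"

definition RC :: "pred set \<Rightarrow> dep set \<Rightarrow> bool list set" where
  "RC S Sig = {w. \<exists>fs gs. w = enc_pair fs gs \<and> is_db S (set fs) \<and> is_db S (set gs) \<and>
                          is_repair Sig (set fs) (set gs)}"

end

theory Submission
  imports Defs "HOL-Library.Countable"
begin

text \<open>The single dependency $R(x_0,x_1,x_2,x_3) \to \exists\ldots\, R(x_1,\ldots) \wedge R(x_2,\ldots)
  \wedge R(x_3,\ldots) \wedge R(1,\ldots)$ is linear, and sticky because its body repeats no variable.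
  A fact is read as the rule ``$x_0$ is derivable from $x_1, x_2, x_3$'': a nonempty subset of a
  database is consistent iff all constants occurring in it, and the root $1$, have possibly infinite derivations
  inside it, so the empty set is a repair iff the root has none. Given a machine deciding a language in polynomial
  time, the rules express how state, head positions and cell contents at time $t + 1$ follow from those at
  time $t$; as time decreases along every derivation, infinite derivations add nothing, and the root is
  derivable iff the machine rejects.

  Constants are chosen so that the reduction needs no arithmetic beyond successors: a constant lists the
  digits of a few numbers, least significant first and in unary, so that its binary encoding can be
  printed during one left-to-right pass over a logarithmic counter.\<close>

text \<open>Neither linearity nor stickiness limits branching: one body atom demands several head
  atoms (conjunction), and several facts with the same first constant offer a choice (disjunction).
  This is an and-or graph. Consistent subsets are closed under union, so consistency is a
  greatest-fixpoint notion and cannot by itself exclude circular support; this is why the rules have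
  to be well-founded in time. The head atom on the constant 1 ties emptiness to the root. Without
  it, a circular filler rule alone would be a nonempty consistent set and would say nothing about
  the machine. An empty repair means that the root has no support, so the root has to stand for
  rejection.\<close>

declare bin.simps [simp del]

subsection \<open>Unique decodability\<close>

lemma set_bin: "set (bin n) \<subseteq> {T0, T1}"
  by (induction n rule: bin.induct) (subst bin.simps, auto)

lemma bin_eq_iff [simp]: "bin m = bin n \<longleftrightarrow> m = n"
proof
  define val where "val = (\<lambda>ts. foldr (\<lambda>t v. (if t = T1 then 1 else 0) + 2 * v) ts (0::nat))"
  have "val (bin k) = k" for k
  proof (induction k rule: bin.induct)
    case (1 n)
    have "odd n \<Longrightarrow> Suc (2 * (n div 2)) = n" by presburger
    with 1 show ?case
      by (subst bin.simps) (auto simp: val_def)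
  qed
  then show "bin m = bin n \<Longrightarrow> m = n"
    by metis
qed simp

text \<open>The list sits below a top bit 1, which protects trailing \<open>False\<close> entries.
  The \<open>bin\<close> word is thus the list followed by \<open>T1\<close> and can be printed on
  the fly. The empty list yields 1, the constant reserved for the root.\<close>

primrec bits_nat :: "bool list \<Rightarrow> nat" where
  "bits_nat [] = 1"
| "bits_nat (b # bs) = of_bool b + 2 * bits_nat bs"

abbreviation bit_tok :: "bool \<Rightarrow> tok" where
  "bit_tok b \<equiv> if b then T1 else T0"

lemma bits_nat_pos: "0 < bits_nat bs"
  by (induction bs) auto

lemma bin_bits_nat: "bin (bits_nat bs) = map bit_tok bs @ [T1]"
proof (induction bs)
  case Nil
  then show ?case by (simp add: bin.simps)
next
  case (Cons b bs)
  then show ?case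
    using bits_nat_pos[of bs] by (subst bin.simps) auto
qed

lemma inj_bits_nat: "inj bits_nat"
proof (rule injI)
  fix xs ys assume "bits_nat xs = bits_nat ys"
  then have "map bit_tok xs = map bit_tok ys"
    by (metis bin_bits_nat append1_eq_conv)
  moreover have "inj bit_tok"
    by (auto simp: inj_def split: if_splits)
  ultimately show "xs = ys"
    by (simp add: inj_map_eq_map)
qed

definition sep_bins :: "nat \<Rightarrow> nat list \<Rightarrow> tok list" where
  "sep_bins a l = bin a @ concat (map (\<lambda>c. TSep # bin c) l)"

lemma sep_bins_Cons: "sep_bins a (c # l) = bin a @ TSep # sep_bins c l"
  by (simp add: sep_bins_def)

lemma set_sep_bins: "TEnd \<notin> set (sep_bins a l)"
proof -
  have "TEnd \<notin> set (bin n)" for n using set_bin[of n] by auto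
  then show ?thesis by (auto simp: sep_bins_def)
qed

lemma append_sep_eqD: "xs @ s # r = ys @ s # r' \<Longrightarrow> s \<notin> set xs \<Longrightarrow> s \<notin> set ys \<Longrightarrow> xs = ys \<and> r = r'"
proof (induction xs arbitrary: ys)
  case Nil
  then show ?case by (cases ys) auto
next
  case (Cons x xs)
  then show ?case by (cases ys) auto
qed

lemma sep_bins_inj: "sep_bins a l = sep_bins a' l' \<Longrightarrow> a = a' \<and> l = l'"
proof (induction l arbitrary: a a' l')
  case Nil
  have "TSep \<notin> set (bin a)" using set_bin[of a] by auto
  with Nil show ?case
    by (cases l') (auto simp: sep_bins_def)
next
  case (Cons c l)
  have s: "TSep \<notin> set (bin a)" "TSep \<notin> set (bin a')" using set_bin[of a] set_bin[of a'] by auto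
  show ?case
  proof (cases l')
    case Nil
    with Cons.prems have "TSep \<in> set (bin a')"
      by (metis append_Nil2 concat.simps(1) in_set_conv_decomp list.simps(8) sep_bins_Cons sep_bins_def)
    with s show ?thesis by simp
  next
    case (Cons c' k)
    then have "bin a @ TSep # sep_bins c l = bin a' @ TSep # sep_bins c' k"
      using Cons.prems by (simp add: sep_bins_Cons)
    from append_sep_eqD[OF this s] have "bin a = bin a'" "sep_bins c l = sep_bins c' k"
      by auto
    then show ?thesis
      using Cons.IH[of c c' k] Cons by simp
  qed
qed

lemma enc_fact_P: "enc_fact (P a k, cs) = sep_bins a (k # cs) @ [TEnd]"
  by (simp add: sep_bins_def)

text \<open>A \<open>Bot\<close> fact would be encoded as a lone \<open>TEnd\<close>, just like the
  end of a database; every other fact starts with \<open>T0\<close>, \<open>T1\<close> or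
  \<open>TSep\<close>. The remainders \<open>r\<close> and \<open>r'\<close> allow the first
  database of a pair to be split off.\<close>

lemma enc_db_inj:
  assumes "\<forall>f\<in>set fs. fst f \<noteq> Bot" "\<forall>f\<in>set gs. fst f \<noteq> Bot" "enc_db fs @ r = enc_db gs @ r'"
  shows "fs = gs \<and> r = r'"
  using assms
proof (induction fs arbitrary: gs)
  case Nil
  show ?case
  proof (cases gs)
    case Nil
    then show ?thesis using Nil.prems by (simp add: enc_db_def)
  next
    case (Cons g gs')
    with Nil.prems obtain a k cs where "g = (P a k, cs)"
      by (metis arity.cases fst_conv list.set_intros(1) surj_pair)
    with Cons Nil.prems set_bin[of a] show ?thesis
      by (cases "bin a") (auto simp: enc_db_def)
  qed
next
  case (Cons f fs)
  then obtain a k cs where f: "f = (P a k, cs)"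
    by (metis arity.cases fst_conv list.set_intros(1) surj_pair)
  show ?case
  proof (cases gs)
    case Nil
    then show ?thesis using Cons.prems f set_bin[of a]
      by (cases "bin a") (auto simp: enc_db_def)
  next
    case gs: (Cons g gs')
    with Cons.prems obtain a' k' cs' where g: "g = (P a' k', cs')"
      by (metis arity.cases fst_conv list.set_intros(1) surj_pair)
    have "sep_bins a (k # cs) @ TEnd # (enc_db fs @ r) = sep_bins a' (k' # cs') @ TEnd # (enc_db gs' @ r')"
      using Cons.prems(3) unfolding f g gs
      by (simp add: enc_db_def enc_fact_P del: enc_fact.simps)
    from append_sep_eqD[OF this set_sep_bins set_sep_bins]
    have *: "sep_bins a (k # cs) = sep_bins a' (k' # cs')" "enc_db fs @ r = enc_db gs' @ r'"
      by auto
    from sep_bins_inj[OF *(1)] have "f = g" by (simp add: f g)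
    moreover have "fs = gs' \<and> r = r'"
      using Cons.IH[of gs'] Cons.prems gs *(2) by simp
    ultimately show ?thesis using gs by simp
  qed
qed

lemma tok_bits_concat_inj:
  "concat (map tok_bits xs) = concat (map tok_bits ys) \<Longrightarrow> xs = ys"
proof (induction xs arbitrary: ys)
  case Nil
  then show ?case
    by (cases ys; cases "hd ys") auto
next
  case (Cons x xs)
  then obtain y ys' where ys: "ys = y # ys'"
    by (cases ys; cases x) auto
  with Cons.prems have "x = y" "concat (map tok_bits xs) = concat (map tok_bits ys')"
    by (cases x; cases y; simp)+
  with Cons.IH ys show ?case by simp
qed

lemma enc_pair_inj:
  assumes "is_db S (set fs)" "is_db S (set gs)" "is_db S (set fs')" "is_db S (set gs')"
    and "enc_pair fs gs = enc_pair fs' gs'"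
  shows "fs = fs' \<and> gs = gs'"
proof -
  have nb: "\<forall>f\<in>set l. fst f \<noteq> Bot" if "is_db S (set l)" for l
    using that by (auto simp: is_db_def)
  have "enc_db fs @ enc_db gs = enc_db fs' @ enc_db gs'"
    using tok_bits_concat_inj assms(5) unfolding enc_pair_def by blast
  with enc_db_inj[OF nb nb] assms have "fs = fs'" "enc_db gs = enc_db gs'" by blast+
  with enc_db_inj[OF nb nb, of gs gs' "[]" "[]"] assms show ?thesis by simp
qed

subsection \<open>The dependency and its consistent subsets\<close>

abbreviation Rl :: pred where "Rl \<equiv> P 0 4"

text \<open>No existential variable is shared between head atoms, so each atom asks only that its
  first entry be the first entry of some fact.\<close>

definition and_or_dep :: dep where
  "and_or_dep = ([Atom Rl [Var 0, Var 1, Var 2, Var 3]],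
     [([4..<16], [Atom Rl [Var 1, Var 4, Var 5, Var 6], Atom Rl [Var 2, Var 7, Var 8, Var 9],
                  Atom Rl [Var 3, Var 10, Var 11, Var 12], Atom Rl [Cst 1, Var 13, Var 14, Var 15]])])"

definition sources :: "fact set \<Rightarrow> nat set" where
  "sources D = {x. \<exists>a b c. (Rl, [x, a, b, c]) \<in> D}"

lemma wf_and_or_dep: "wf_dep {Bot, Rl} and_or_dep"
  by (simp add: wf_dep_def and_or_dep_def wf_conj_def vars_conj_def atom_vars_def insert_Diff_if del: set_filter)

lemma linear_and_or_dep: "linear_deps {and_or_dep}"
  by (simp add: linear_deps_def and_or_dep_def)

lemma sticky_and_or_dep: "sticky {and_or_dep}"
  by (simp add: sticky_def and_or_dep_def occ_def)

lemma consistent_iff: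
  "consistent {and_or_dep} D \<longleftrightarrow>
     (\<forall>x y z u. (Rl, [x, y, z, u]) \<in> D \<longrightarrow> {y, z, u, 1} \<subseteq> sources D)" (is "_ \<longleftrightarrow> ?R")
proof
  assume L: "consistent {and_or_dep} D"
  show ?R
  proof (intro allI impI)
    fix x y z u assume "(Rl, [x, y, z, u]) \<in> D"
    then have "sat_conj D (\<lambda>i. [x, y, z, u] ! i) (fst and_or_dep)"
      by (simp add: sat_conj_def and_or_dep_def)
    with L obtain h where "\<forall>i. i \<notin> set [4..<16] \<longrightarrow> h i = [x, y, z, u] ! i"
      and h: "sat_conj D h (snd (snd and_or_dep ! 0))"
      unfolding consistent_def satisfies_def and_or_dep_def sat_cq_def by fastforce
    then have "h 1 = y" "h 2 = z" "h 3 = u" by auto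
    with h show "{y, z, u, 1} \<subseteq> sources D"
      by (auto simp: sat_conj_def and_or_dep_def sources_def)
  qed
next
  assume R: ?R
  have "\<exists>q\<in>set (snd and_or_dep). sat_cq D h q" if "sat_conj D h (fst and_or_dep)" for h
  proof -
    from that have "{h 1, h 2, h 3, 1} \<subseteq> sources D"
      using R unfolding sat_conj_def and_or_dep_def by simp
    then obtain a b c a' b' c' a'' b'' c'' d e f
      where w: "(Rl, [h 1, a, b, c]) \<in> D" "(Rl, [h 2, a', b', c']) \<in> D"
        "(Rl, [h 3, a'', b'', c'']) \<in> D" "(Rl, [1, d, e, f]) \<in> D"
      by (auto simp: sources_def)
    \<comment> \<open>The existential variables are 4 to 15, three per head atom, whence the offset
      4 into the list of witnesses.\<close>
    define h' where "h' = (\<lambda>i. if i < 4 \<or> 16 \<le> i then h i else [a, b, c, a', b', c', a'', b'', c'', d, e, f] ! (i - 4))"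
    have "\<forall>x. x \<notin> set [4..<16] \<longrightarrow> h' x = h x" unfolding set_upt h'_def by auto
    moreover have "sat_conj D h' (snd (snd and_or_dep ! 0))"
      using w by (simp add: sat_conj_def h'_def and_or_dep_def)
    ultimately have "sat_cq D h ([4..<16], snd (snd and_or_dep ! 0))"
      unfolding sat_cq_def prod.case by blast
    then show ?thesis unfolding and_or_dep_def by (simp del: upt_rec_numeral)
  qed
  then show "consistent {and_or_dep} D"
    by (simp add: consistent_def satisfies_def case_prod_beta)
qed

text \<open>A subset is consistent iff its sources form a post-fixpoint of the rules ``a source needs one
  rule all of whose targets are sources'', so the empty set is a repair iff the root has no,
  possibly infinite, derivation.\<close>

lemma empty_repair_iff:
  fixes code :: "'n \<Rightarrow> nat"
  assumes inj: "inj code" and rt: "code rt = 1"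
    and D: "D = (\<lambda>r. (Rl, map code r)) ` RR"
    and len: "\<And>r. r \<in> RR \<Longrightarrow> length r = 4"
  shows "is_repair {and_or_dep} D {} \<longleftrightarrow>
    \<not> (\<exists>H. rt \<in> H \<and> (\<forall>n\<in>H. \<exists>n1\<in>H. \<exists>n2\<in>H. \<exists>n3\<in>H. [n, n1, n2, n3] \<in> RR))"
proof -
  have inD: "(Rl, [code n, x, y, z]) \<in> D \<longleftrightarrow>
      (\<exists>n1 n2 n3. x = code n1 \<and> y = code n2 \<and> z = code n3 \<and> [n, n1, n2, n3] \<in> RR)" for n x y z
  proof
    assume "(Rl, [code n, x, y, z]) \<in> D"
    then obtain r where r: "r \<in> RR" "map code r = [code n, x, y, z]" unfolding D by auto
    then obtain m n1 n2 n3 where "r = [m, n1, n2, n3]" by (auto simp: map_eq_Cons_conv)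
    with r have "m = n" "x = code n1 \<and> y = code n2 \<and> z = code n3 \<and> [m, n1, n2, n3] \<in> RR"
      using injD[OF inj] by auto
    then show "\<exists>n1 n2 n3. x = code n1 \<and> y = code n2 \<and> z = code n3 \<and> [n, n1, n2, n3] \<in> RR"
      by blast
  next
    assume "\<exists>n1 n2 n3. x = code n1 \<and> y = code n2 \<and> z = code n3 \<and> [n, n1, n2, n3] \<in> RR"
    then show "(Rl, [code n, x, y, z]) \<in> D" unfolding D by force
  qed
  have "(\<exists>E. E \<noteq> {} \<and> E \<subseteq> D \<and> consistent {and_or_dep} E) \<longleftrightarrow>
    (\<exists>H. rt \<in> H \<and> (\<forall>n\<in>H. \<exists>n1\<in>H. \<exists>n2\<in>H. \<exists>n3\<in>H. [n, n1, n2, n3] \<in> RR))" (is "?L \<longleftrightarrow> ?R")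
  proof
    assume ?L
    then obtain E where E: "E \<noteq> {}" "E \<subseteq> D" "consistent {and_or_dep} E" by blast
    define H where "H = {n. code n \<in> sources E}"
    \<comment> \<open>The fourth head atom acts here: any fact of \<open>E\<close> makes the root a
      source.\<close>
    from E(1) obtain e where e: "e \<in> E" by auto
    with E(2) obtain r where r: "r \<in> RR" "e = (Rl, map code r)" unfolding D by auto
    from len[OF r(1)] obtain a b c d where "map code r = [a, b, c, d]"
      by (auto simp: numeral_eq_Suc length_Suc_conv)
    with e r E(3) have "1 \<in> sources E" unfolding consistent_iff by auto
    then have "rt \<in> H" by (simp add: H_def rt)
    moreover have "\<exists>n1\<in>H. \<exists>n2\<in>H. \<exists>n3\<in>H. [n, n1, n2, n3] \<in> RR" if "n \<in> H" for n
    proof -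
      from that obtain x y z where xyz: "(Rl, [code n, x, y, z]) \<in> E" by (auto simp: H_def sources_def)
      with E(2) inD obtain n1 n2 n3 where n: "x = code n1" "y = code n2" "z = code n3" "[n, n1, n2, n3] \<in> RR"
        by blast
      from xyz E(3) have "{x, y, z} \<subseteq> sources E" unfolding consistent_iff by blast
      with n show ?thesis unfolding H_def by auto
    qed
    ultimately show ?R by blast
  next
    assume ?R
    then obtain H where H: "rt \<in> H"
      "\<And>n. n \<in> H \<Longrightarrow> \<exists>n1\<in>H. \<exists>n2\<in>H. \<exists>n3\<in>H. [n, n1, n2, n3] \<in> RR" by blast
    \<comment> \<open>Rules that leave \<open>H\<close> are dropped, so that every constant
      occurring in \<open>E\<close> codes a node of \<open>H\<close>.\<close>
    define E where "E = (\<lambda>r. (Rl, map code r)) ` {r \<in> RR. set r \<subseteq> H}"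
    have src: "code n \<in> sources E" if n: "n \<in> H" for n
    proof -
      from H(2)[OF n] obtain n1 n2 n3 where "[n, n1, n2, n3] \<in> RR" "{n, n1, n2, n3} \<subseteq> H"
        using n by blast
      then have "(Rl, map code [n, n1, n2, n3]) \<in> E" unfolding E_def by (intro imageI) simp
      then show ?thesis unfolding sources_def by auto
    qed
    have "E \<subseteq> D" unfolding E_def D by auto
    moreover have "consistent {and_or_dep} E" unfolding consistent_iff
    proof (intro allI impI)
      fix x y z u assume "(Rl, [x, y, z, u]) \<in> E"
      then obtain r where r: "set r \<subseteq> H" "(Rl, [x, y, z, u]) = (Rl, map code r)"
        by (metis (no_types, lifting) E_def imageE mem_Collect_eq)
      have "set [x, y, z, u] = code ` set r" using r(2) by (simp only: prod.inject image_set[symmetric])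
      then have "set [x, y, z, u] \<subseteq> sources E" using r(1) src by auto
      moreover have "1 \<in> sources E" using src[OF H(1)] rt by simp
      ultimately show "{y, z, u, 1} \<subseteq> sources E" by simp
    qed
    moreover have "E \<noteq> {}" using src[OF H(1)] by (auto simp: sources_def)
    ultimately show ?L by blast
  qed
  moreover have "is_repair {and_or_dep} D {} \<longleftrightarrow> \<not> (\<exists>E. E \<noteq> {} \<and> E \<subseteq> D \<and> consistent {and_or_dep} E)"
    unfolding is_repair_def by (auto simp: consistent_iff[of "{}"])
  ultimately show ?thesis by simp
qed

subsection \<open>Derivations describing the run of a machine\<close>

text \<open>\<open>NS q t i p\<close>: at time \<open>t\<close> the state is \<open>q\<close> and the heads are at \<open>i\<close> (input) and \<open>p\<close> (work);
  \<open>NW s t p\<close>: at time \<open>t\<close> work cell \<open>p\<close> holds \<open>s\<close>; \<open>NI a i\<close>: the input symbol at \<open>i\<close> is \<open>a\<close>;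
  \<open>NLt x y\<close>: \<open>x < y\<close>, needed to say that a cell away from the head keeps its symbol.\<close>

datatype 'f node = NS nat 'f 'f 'f | NW nat 'f 'f | NI isym 'f | NLt 'f 'f | NTrue | NRoot

text \<open>Halted configurations loop in place, as under \<open>step\<close>, so that every time
  step, halted or not, follows the same rules. The output bit is irrelevant for acceptance and is
  dropped.\<close>

fun halt_delta :: "tm \<Rightarrow> nat \<Rightarrow> isym \<Rightarrow> nat \<Rightarrow> nat \<times> nat \<times> move \<times> move" where
  "halt_delta M q a s = (if q = acc M \<or> q = rej M then (q, s, MvS, MvS)
     else case delta M q a s of (q', s', mi, mw, _) \<Rightarrow> (q', s', mi, mw))"

declare halt_delta.simps [simp del]

text \<open>\<open>step\<close> clips the input head at \<open>Suc (length w)\<close>. The scanned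
  end marker carries the same information, so the rules for a move need not mention the input
  length.\<close>

definition imv :: "move \<Rightarrow> isym \<Rightarrow> nat \<Rightarrow> nat" where
  "imv mi a i = (if mi = MvL \<and> a = LEnd \<or> mi = MvR \<and> a = REnd then i else mv mi i)"

lemma imv_input_sym:
  "i \<le> Suc (length w) \<Longrightarrow> imv mi (input_sym w i) i = min (Suc (length w)) (mv mi i)"
  by (cases mi) (auto simp: imv_def input_sym_def split: if_splits)

lemma run_Suc: "run M w (Suc t) = step M w (run M w t)"
  by (simp add: run_def)

lemma ipos_run_le: "ipos (run M w t) \<le> Suc (length w)"
  by (induction t) (auto simp: run_Suc step_def split: prod.splits, simp add: run_def init_def)

lemma wpos_run_le: "wpos (run M w t) \<le> t"
proof (induction t)
  case 0
  then show ?case by (simp add: run_def init_def)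
next
  case (Suc t)
  have "mv mw p \<le> Suc t" if "p \<le> t" for mw p using that by (cases mw) auto
  with Suc show ?case by (auto simp: run_Suc step_def split: prod.splits)
qed

lemma halt_delta_step:
  assumes "halt_delta M (cst c) (input_sym w (ipos c)) (wtape c (wpos c)) = (q', s', mi, mw)"
    and "ipos c \<le> Suc (length w)"
  shows "cst (step M w c) = q'" "ipos (step M w c) = imv mi (input_sym w (ipos c)) (ipos c)"
    "wpos (step M w c) = mv mw (wpos c)" "wtape (step M w c) = (wtape c)(wpos c := s')"
  using assms
  by (auto simp: halt_delta.simps step_def halted_def imv_input_sym split: if_splits prod.splits)

lemma run_closed:
  assumes "wf_tm M"
  shows "cst (run M w t) \<in> states M \<and> (\<forall>p. wtape (run M w t) p \<in> syms M)"
proof (induction t)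
  case 0
  then show ?case using assms by (auto simp: run_def init_def wf_tm_def)
next
  case (Suc t)
  then show ?case using assms
    by (auto simp: run_Suc step_def wf_tm_def split: prod.splits) blast+
qed

type_synonym field = "nat \<times> nat"

text \<open>The field \<open>(r, c)\<close> denotes the value of track \<open>r\<close> plus \<open>c\<close>. The tracks range over an input
  position, a time and two work-tape positions; track 4 is constantly zero.\<close>

abbreviation (input) fI :: field where "fI \<equiv> (0, 0)"
abbreviation (input) fI' :: field where "fI' \<equiv> (0, 1)"
abbreviation (input) fT :: field where "fT \<equiv> (1, 0)"
abbreviation (input) fT' :: field where "fT' \<equiv> (1, 1)"
abbreviation (input) fP :: field where "fP \<equiv> (2, 0)"
abbreviation (input) fP' :: field where "fP' \<equiv> (2, 1)"
abbreviation (input) fU :: field where "fU \<equiv> (3, 0)"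
abbreviation (input) fZ :: field where "fZ \<equiv> (4, 0)"

text \<open>Pairs (field before the move, field after the move). A left move is read backwards, from
  position \<open>x + 1\<close> to \<open>x\<close>, so that only successors are needed.\<close>

fun imove :: "move \<Rightarrow> isym \<Rightarrow> field \<times> field" where
  "imove MvL a = (if a = LEnd then (fI, fI) else (fI', fI))"
| "imove MvS a = (fI, fI)"
| "imove MvR a = (if a = REnd then (fI, fI) else (fI, fI'))"

text \<open>Nothing marks cell 0 of the work tape, where \<open>mv MvL 0 = 0\<close>; the pair on
  the zero track covers this case.\<close>

fun pmove :: "move \<Rightarrow> (field \<times> field) set" where
  "pmove MvL = {(fP', fP), (fZ, fZ)}"
| "pmove MvS = {(fP, fP)}"
| "pmove MvR = {(fP, fP')}"

text \<open>A new cell content, like a new state, has three premises: the state with the head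
  positions, the scanned work symbol and the scanned input symbol. This fixes the arity of
  \<open>Rl\<close> at 4.\<close>

definition step_templates :: "tm \<Rightarrow> nat \<Rightarrow> isym \<Rightarrow> nat \<Rightarrow> field node list set" where
  "step_templates M q a s = (case halt_delta M q a s of (q', s', mi, mw) \<Rightarrow>
     insert [NW s' fT' fP, NS q fT fI fP, NW s fT fP, NI a fI]
       ((\<lambda>(pb, ph). [NS q' fT' (snd (imove mi a)) ph, NS q fT (fst (imove mi a)) pb,
           NW s fT pb, NI a (fst (imove mi a))]) ` pmove mw))"

lemma step_templates_iff:
  "\<rho> \<in> step_templates M q a s \<longleftrightarrow> (\<exists>q' s' mi mw. halt_delta M q a s = (q', s', mi, mw) \<and>
     (\<rho> = [NW s' fT' fP, NS q fT fI fP, NW s fT fP, NI a fI] \<or>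
      (\<exists>(pb, ph)\<in>pmove mw. \<rho> = [NS q' fT' (snd (imove mi a)) ph, NS q fT (fst (imove mi a)) pb,
           NW s fT pb, NI a (fst (imove mi a))])))"
  unfolding step_templates_def by (cases "halt_delta M q a s") auto

text \<open>\<open>NTrue\<close> supports itself and pads rules with fewer than three premises. The
  order is generated by successors, the time track serving there as a plain second counter. Rules
  for \<open>NI\<close> are left out because they depend on the input.\<close>

definition templates :: "tm \<Rightarrow> field node list set" where
  "templates M =
     {[NTrue, NTrue, NTrue, NTrue],
      [NLt fI fI', NTrue, NTrue, NTrue],
      [NLt fI fT', NLt fI fT, NTrue, NTrue],
      [NW 0 fZ fP, NTrue, NTrue, NTrue],
      [NS (start M) fZ fZ fZ, NTrue, NTrue, NTrue],
      [NRoot, NS (rej M) fT fI fP, NTrue, NTrue]}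
   \<union> (\<Union>q\<in>states M. \<Union>s\<in>syms M. {[NW s fT' fU, NS q fT fI fP, NW s fT fU, NLt fP fU],
                                  [NW s fT' fU, NS q fT fI fP, NW s fT fU, NLt fU fP]})
   \<union> (\<Union>q\<in>states M. \<Union>s\<in>syms M. \<Union>a. step_templates M q a s)"

definition inst :: "nat list \<Rightarrow> field \<Rightarrow> nat" where
  "inst X = (\<lambda>(r, c). (X @ [0]) ! r + c)"

definition rules :: "tm \<Rightarrow> bool list \<Rightarrow> nat \<Rightarrow> nat node list set" where
  "rules M w N =
     {map (map_node (inst [i, t, p, u])) \<rho> | \<rho> i t p u. \<rho> \<in> templates M \<and> i < N \<and> t < N \<and> p < N \<and> u < N}
   \<union> {[NI (input_sym w i) i, NTrue, NTrue, NTrue] | i. i < length w + 2}"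

lemma inst_time: "inst [i, t, p, u] (Suc 0, c) = t + c"
  by (simp add: inst_def)

lemma step_templates_subset:
  "q \<in> states M \<Longrightarrow> s \<in> syms M \<Longrightarrow> step_templates M q a s \<subseteq> templates M"
  unfolding templates_def by (rule le_supI2) auto

lemma rules_instI:
  assumes "\<rho> \<in> templates M" "i < N" "t < N" "p < N" "u < N" "r = map (map_node (inst [i, t, p, u])) \<rho>"
  shows "r \<in> rules M w N"
  using assms unfolding rules_def by blast

lemma length_rules: "r \<in> rules M w N \<Longrightarrow> length r = 4"
  by (auto simp: rules_def templates_def step_templates_iff)

lemma rules_NLt: "[NLt x y, n1, n2, n3] \<in> rules M w N \<Longrightarrow> y = Suc x \<or> (\<exists>y'. y = Suc y' \<and> n1 = NLt x y')"
  by (auto simp: rules_def templates_def step_templates_iff inst_def)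

lemma rules_NI: "[NI a i, n1, n2, n3] \<in> rules M w N \<Longrightarrow> a = input_sym w i"
  by (auto simp: rules_def templates_def step_templates_iff inst_def)

lemma rules_NRoot: "[NRoot, n1, n2, n3] \<in> rules M w N \<Longrightarrow> \<exists>t i p. n1 = NS (rej M) t i p"
  by (auto simp: rules_def templates_def step_templates_iff inst_def)

lemma rules_NW:
  assumes "[NW s' t p, n1, n2, n3] \<in> rules M w N"
  shows "t = 0 \<and> s' = 0 \<or>
    (\<exists>t' q i p'. t = Suc t' \<and> n1 = NS q t' i p' \<and> n2 = NW s' t' p \<and> (n3 = NLt p p' \<or> n3 = NLt p' p)) \<or>
    (\<exists>t' q i a s q' mi mw. t = Suc t' \<and> n1 = NS q t' i p \<and> n2 = NW s t' p \<and> n3 = NI a i \<and>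
       halt_delta M q a s = (q', s', mi, mw))"
  using assms
  by (auto simp: rules_def templates_def step_templates_iff inst_def)

lemma rules_NS:
  assumes "[NS q' t i' p', n1, n2, n3] \<in> rules M w N"
  shows "t = 0 \<and> q' = start M \<and> i' = 0 \<and> p' = 0 \<or>
    (\<exists>t' q i p a s s' mi mw. t = Suc t' \<and> n1 = NS q t' i p \<and> n2 = NW s t' p \<and> n3 = NI a i \<and>
       halt_delta M q a s = (q', s', mi, mw) \<and> i' = imv mi a i \<and> p' = mv mw p)"
proof -
  have pm: "(pb, ph) \<in> pmove mw \<Longrightarrow> inst [i, t, p, u] ph = mv mw (inst [i, t, p, u] pb)" for i t p u pb ph mw
    by (cases mw) (auto simp: inst_def)
  have im: "inst [i, t, p, u] (snd (imove mi a)) = imv mi a (inst [i, t, p, u] (fst (imove mi a)))" for i t p u mi a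
    by (cases mi) (auto simp: inst_def imv_def)
  have T: "inst [i, t, p, u] (Suc 0, Suc 0) = Suc t" "inst [i, t, p, u] (Suc 0, 0) = t" "inst [i, t, p, u] fZ = 0" for i t p u
    by (auto simp: inst_def)
  from assms show ?thesis
    by (auto simp: rules_def templates_def step_templates_iff pm im T)
qed

text \<open>States and cell contents depend on one another, so one induction on time treats both.
  Order nodes have their own induction, on the second argument, and an input node has only one kind
  of rule.\<close>

lemma post_fixpoint_sound:
  assumes H: "\<And>n. n \<in> H \<Longrightarrow> \<exists>n1\<in>H. \<exists>n2\<in>H. \<exists>n3\<in>H. [n, n1, n2, n3] \<in> rules M w N"
  shows "NLt x y \<in> H \<Longrightarrow> x < y"
    and "NI a i \<in> H \<Longrightarrow> a = input_sym w i"
    and "NS q t i p \<in> H \<Longrightarrow> q = cst (run M w t) \<and> i = ipos (run M w t) \<and> p = wpos (run M w t)"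
    and "NW s t p \<in> H \<Longrightarrow> s = wtape (run M w t) p"
proof -
  show Lt: "NLt x y \<in> H \<Longrightarrow> x < y" for x y
  proof (induction y)
    case 0
    with H rules_NLt show ?case by (metis Zero_not_Suc)
  next
    case (Suc y)
    with H rules_NLt show ?case by (metis lessI less_SucI old.nat.inject)
  qed
  show I: "NI a i \<in> H \<Longrightarrow> a = input_sym w i" for a i
    using H rules_NI by meson
  have "(\<forall>q i p. NS q t i p \<in> H \<longrightarrow> q = cst (run M w t) \<and> i = ipos (run M w t) \<and> p = wpos (run M w t)) \<and>
        (\<forall>s p. NW s t p \<in> H \<longrightarrow> s = wtape (run M w t) p)" for t
  proof (induction t)
    case 0
    have "q = start M \<and> i = 0 \<and> p = 0" if "NS q 0 i p \<in> H" for q i p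
      using H[OF that] rules_NS by blast
    moreover have "s = 0" if "NW s 0 p \<in> H" for s p
      using H[OF that] rules_NW by blast
    ultimately show ?case by (auto simp: run_def init_def)
  next
    case (Suc t)
    let ?c = "run M w t"
    note st = halt_delta_step[where M = M and w = w and c = ?c, OF _ ipos_run_le]
    show ?case
    proof (rule conjI; intro allI impI)
      fix q' i' p' assume "NS q' (Suc t) i' p' \<in> H"
      from H[OF this] obtain n1 n2 n3 where n: "n1 \<in> H" "n2 \<in> H" "n3 \<in> H"
        and r: "[NS q' (Suc t) i' p', n1, n2, n3] \<in> rules M w N" by blast
      from rules_NS[OF r] n obtain q i p a s s' mi mw where
        "NS q t i p \<in> H" "NW s t p \<in> H" "NI a i \<in> H" and d: "halt_delta M q a s = (q', s', mi, mw)"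
        "i' = imv mi a i" "p' = mv mw p" by auto
      with Suc I have "q = cst ?c" "i = ipos ?c" "p = wpos ?c" "s = wtape ?c (wpos ?c)" "a = input_sym w (ipos ?c)"
        by blast+
      with d st show "q' = cst (run M w (Suc t)) \<and> i' = ipos (run M w (Suc t)) \<and> p' = wpos (run M w (Suc t))"
        unfolding run_Suc by metis
    next
      fix s' p assume "NW s' (Suc t) p \<in> H"
      from H[OF this] obtain n1 n2 n3 where n: "n1 \<in> H" "n2 \<in> H" "n3 \<in> H"
        and r: "[NW s' (Suc t) p, n1, n2, n3] \<in> rules M w N" by blast
      from rules_NW[OF r] n consider
        (keep) q i p' where "NS q t i p' \<in> H" "NW s' t p \<in> H" "NLt p p' \<in> H \<or> NLt p' p \<in> H"
        | (wr) q i a s q' mi mw where "NS q t i p \<in> H" "NW s t p \<in> H" "NI a i \<in> H"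
           "halt_delta M q a s = (q', s', mi, mw)" by auto
      then show "s' = wtape (run M w (Suc t)) p"
      proof cases
        case keep
        \<comment> \<open>An order node in either direction separates the cell from the head, so its
          symbol survives the step.\<close>
        with Suc Lt have p: "p \<noteq> wpos ?c" and s: "s' = wtape ?c p" by blast+
        obtain q' s'' mi mw where "halt_delta M (cst ?c) (input_sym w (ipos ?c)) (wtape ?c (wpos ?c)) = (q', s'', mi, mw)"
          by (metis prod_cases4)
        from st(4)[OF this] p s show ?thesis unfolding run_Suc by simp
      next
        case wr
        with Suc I have "q = cst ?c" "i = ipos ?c" "p = wpos ?c" "s = wtape ?c (wpos ?c)" "a = input_sym w (ipos ?c)"
          by blast+
        with wr st(4) show ?thesis unfolding run_Suc by (metis fun_upd_same)
      qed
    qed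
  qed
  then show "NS q t i p \<in> H \<Longrightarrow> q = cst (run M w t) \<and> i = ipos (run M w t) \<and> p = wpos (run M w t)"
    and "NW s t p \<in> H \<Longrightarrow> s = wtape (run M w t) p" by blast+
qed

text \<open>The witness collects the true nodes up to time \<open>t0\<close>. The work head is never
  farther out than the current time, so instances with all tracks below \<open>N\<close> suffice to
  support them.\<close>

lemma post_fixpoint_complete:
  assumes wf: "wf_tm M" and N: "length w + 1 < N" "t0 < N" and rej: "cst (run M w t0) = rej M"
  shows "\<exists>H. NRoot \<in> H \<and> (\<forall>n\<in>H. \<exists>n1\<in>H. \<exists>n2\<in>H. \<exists>n3\<in>H. [n, n1, n2, n3] \<in> rules M w N)"
proof -
  let ?c = "run M w"
  define H where "H = {NRoot, NTrue}
    \<union> {NS (cst (?c t)) t (ipos (?c t)) (wpos (?c t)) | t. t \<le> t0}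
    \<union> {NW (wtape (?c t) p) t p | t p. t \<le> t0 \<and> p < N}
    \<union> {NI (input_sym w i) i | i. i < length w + 2}
    \<union> {NLt x y | x y. x < y \<and> y < N}"
  have iN: "ipos (?c t) < N" for t using ipos_run_le[of M w t] N by simp
  have pN: "wpos (?c t) < N" if "t \<le> t0" for t using wpos_run_le[of M w t] N that by simp
  have HT: "NTrue \<in> H" and HS: "\<And>t. t \<le> t0 \<Longrightarrow> NS (cst (?c t)) t (ipos (?c t)) (wpos (?c t)) \<in> H"
    and HW: "\<And>t p. t \<le> t0 \<Longrightarrow> p < N \<Longrightarrow> NW (wtape (?c t) p) t p \<in> H"
    and HL: "\<And>x y. x < y \<Longrightarrow> y < N \<Longrightarrow> NLt x y \<in> H"
    by (auto simp: H_def)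
  have HI: "NI (input_sym w (ipos (?c t))) (ipos (?c t)) \<in> H" for t
    using ipos_run_le[of M w t] by (auto simp: H_def)
  have "\<exists>n1\<in>H. \<exists>n2\<in>H. \<exists>n3\<in>H. [n, n1, n2, n3] \<in> rules M w N" if "n \<in> H" for n
  proof -
    from that consider "n = NTrue" | "n = NRoot"
      | (NS) t where "t \<le> t0" "n = NS (cst (?c t)) t (ipos (?c t)) (wpos (?c t))"
      | (NW) t p where "t \<le> t0" "p < N" "n = NW (wtape (?c t) p) t p"
      | (NI) i where "i < length w + 2" "n = NI (input_sym w i) i"
      | (NLt) x y where "x < y" "y < N" "n = NLt x y"
      unfolding H_def by blast
    then show ?thesis
    proof cases
      case 1
      have "[NTrue, NTrue, NTrue, NTrue] \<in> rules M w N"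
        by (rule rules_instI[of "[NTrue, NTrue, NTrue, NTrue]" _ 0 _ 0 0 0]) (use N in \<open>auto simp: templates_def\<close>)
      with 1 HT show ?thesis by blast
    next
      case 2
      have "[NRoot, NS (cst (?c t0)) t0 (ipos (?c t0)) (wpos (?c t0)), NTrue, NTrue] \<in> rules M w N"
        by (rule rules_instI[of "[NRoot, NS (rej M) fT fI fP, NTrue, NTrue]" _ "ipos (?c t0)" _ t0 "wpos (?c t0)" 0])
           (use N iN pN rej in \<open>auto simp: templates_def inst_def\<close>)
      with 2 HT HS[of t0] show ?thesis by blast
    next
      case NLt
      show ?thesis
      proof (cases "y = Suc x")
        case True
        have "[NLt x y, NTrue, NTrue, NTrue] \<in> rules M w N"
          by (rule rules_instI[of "[NLt fI fI', NTrue, NTrue, NTrue]" _ x _ 0 0 0])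
             (use N NLt True in \<open>auto simp: templates_def inst_def\<close>)
        with NLt HT show ?thesis by blast
      next
        case False
        with NLt obtain y' where y': "y = Suc y'" "x < y'" by (cases y) auto
        have "[NLt x y, NLt x y', NTrue, NTrue] \<in> rules M w N"
          by (rule rules_instI[of "[NLt fI fT', NLt fI fT, NTrue, NTrue]" _ x _ y' 0 0])
             (use N NLt y' in \<open>auto simp: templates_def inst_def\<close>)
        with NLt y' HT HL[of x y'] show ?thesis by (metis Suc_lessD)
      qed
    next
      case NI
      then have "[n, NTrue, NTrue, NTrue] \<in> rules M w N" unfolding rules_def by blast
      with HT show ?thesis by blast
    next
      case NS
      show ?thesis
      proof (cases t)
        case 0
        have "[n, NTrue, NTrue, NTrue] \<in> rules M w N"
          by (rule rules_instI[of "[NS (start M) fZ fZ fZ, NTrue, NTrue, NTrue]" _ 0 _ 0 0 0])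
             (use N NS 0 in \<open>auto simp: templates_def inst_def run_def init_def\<close>)
        with HT show ?thesis by blast
      next
        case (Suc t')
        let ?q = "cst (?c t')" and ?i = "ipos (?c t')" and ?p = "wpos (?c t')"
        let ?a = "input_sym w ?i" and ?s = "wtape (?c t') ?p"
        obtain q' s' mi mw where d: "halt_delta M ?q ?a ?s = (q', s', mi, mw)" by (metis prod_cases4)
        note st = halt_delta_step[OF d ipos_run_le]
        have t': "t' \<le> t0" "t' < N" using NS Suc N by auto
        \<comment> \<open>A left move is instantiated at the position after the move, hence the
          witness \<open>?i - 1\<close>; the head is not on \<open>LEnd\<close>, so it is not at
          0.\<close>
        obtain i where i: "i < N" "\<And>t p u. inst [i, t, p, u] (fst (imove mi ?a)) = ?i"
          "\<And>t p u. inst [i, t, p, u] (snd (imove mi ?a)) = imv mi ?a ?i"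
        proof (cases "mi = MvL \<and> ?a \<noteq> LEnd")
          case True
          then have "?i \<noteq> 0" by (metis input_sym_def)
          with True iN[of t'] show ?thesis by (intro that[of "?i - 1"]) (auto simp: inst_def imv_def)
        next
          case False
          with iN[of t'] show ?thesis
            by (cases mi) (auto intro!: that[of ?i] simp: inst_def imv_def)
        qed
        \<comment> \<open>The same for the work head, with the zero track for a left move from cell
          0.\<close>
        obtain p pb ph where p: "p < N" "(pb, ph) \<in> pmove mw" "\<And>i t u. inst [i, t, p, u] pb = ?p"
          "\<And>i t u. inst [i, t, p, u] ph = mv mw ?p"
        proof (cases mw)
          case MvL
          show ?thesis
          proof (cases ?p)
            case 0
            with MvL N show ?thesis by (intro that[of 0 fZ fZ]) (auto simp: inst_def)
          next
            case (Suc k)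
            with MvL pN[OF t'(1)] show ?thesis by (intro that[of k fP' fP]) (auto simp: inst_def)
          qed
        next
          case MvS
          with pN[OF t'(1)] show ?thesis by (intro that[of ?p fP fP]) (auto simp: inst_def)
        next
          case MvR
          with pN[OF t'(1)] show ?thesis by (intro that[of ?p fP fP']) (auto simp: inst_def)
        qed
        let ?r = "[NS q' fT' (snd (imove mi ?a)) ph, NS ?q fT (fst (imove mi ?a)) pb,
           NW ?s fT pb, NI ?a (fst (imove mi ?a))]"
        have "?r \<in> step_templates M ?q ?a ?s"
          using p(2) d by (auto simp: step_templates_iff)
        then have "?r \<in> templates M"
          using step_templates_subset run_closed[OF wf, of w t'] by blast
        then have "[n, NS ?q t' ?i ?p, NW ?s t' ?p, NI ?a ?i] \<in> rules M w N"
          by (rule rules_instI[of _ _ i _ t' p 0])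
             (use N t' i p NS Suc st in \<open>auto simp: run_Suc inst_time\<close>)
        with HS[OF t'(1)] HW[OF t'(1) pN[OF t'(1)]] HI[of t'] show ?thesis by blast
      qed
    next
      case NW
      show ?thesis
      proof (cases t)
        case 0
        have "[n, NTrue, NTrue, NTrue] \<in> rules M w N"
          by (rule rules_instI[of "[NW 0 fZ fP, NTrue, NTrue, NTrue]" _ 0 _ 0 p 0])
             (use N NW 0 in \<open>auto simp: templates_def inst_def run_def init_def\<close>)
        with HT show ?thesis by blast
      next
        case (Suc t')
        let ?q = "cst (?c t')" and ?i = "ipos (?c t')" and ?p = "wpos (?c t')"
        let ?a = "input_sym w ?i" and ?s = "wtape (?c t') ?p"
        obtain q' s' mi mw where d: "halt_delta M ?q ?a ?s = (q', s', mi, mw)" by (metis prod_cases4)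
        note st = halt_delta_step[OF d ipos_run_le]
        have t': "t' \<le> t0" "t' < N" using NW Suc N by auto
        have cl: "?q \<in> states M" "\<And>p. wtape (?c t') p \<in> syms M"
          using run_closed[OF wf, of w t'] by auto
        show ?thesis
        proof (cases "p = ?p")
          case True
          let ?r = "[NW s' fT' fP, NS ?q fT fI fP, NW ?s fT fP, NI ?a fI]"
          have "?r \<in> step_templates M ?q ?a ?s"
            using d by (auto simp: step_templates_iff)
          then have "?r \<in> templates M"
            using step_templates_subset cl by blast
          then have "[n, NS ?q t' ?i ?p, NW ?s t' ?p, NI ?a ?i] \<in> rules M w N"
            by (rule rules_instI[of _ _ ?i _ t' ?p 0])
               (use N t' iN[of t'] pN[of t'] True NW Suc st in \<open>auto simp: run_Suc inst_def\<close>)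
          with HS[OF t'(1)] HW[OF t'(1) pN[OF t'(1)]] HI[of t'] show ?thesis by blast
        next
          case False
          define l :: "nat node" where "l = (if ?p < p then NLt ?p p else NLt p ?p)"
          let ?r = "[NW (wtape (?c t') p) fT' fU, NS ?q fT fI fP, NW (wtape (?c t') p) fT fU,
             if ?p < p then NLt fP fU else NLt fU fP]"
          have "?r \<in> templates M"
            using cl unfolding templates_def by auto
          then have "[n, NS ?q t' ?i ?p, NW (wtape (?c t') p) t' p, l] \<in> rules M w N"
            by (rule rules_instI[of _ _ ?i _ t' ?p p])
               (use N t' iN[of t'] pN[of t'] False NW Suc st in \<open>auto simp: run_Suc inst_def l_def\<close>)
          moreover have "l \<in> H" using False NW pN[OF t'(1)] by (auto simp: l_def intro: HL)
          ultimately show ?thesis using HS[OF t'(1)] HW[OF t'(1) NW(2)] by blast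
        qed
      qed
    qed
  qed
  moreover have "NRoot \<in> H" by (simp add: H_def)
  ultimately show ?thesis by blast
qed

lemma halted_run_stays: "halted M (run M w n) \<Longrightarrow> n \<le> m \<Longrightarrow> run M w m = run M w n"
  by (rotate_tac 1, induction m rule: dec_induct) (auto simp: run_Suc step_def)

lemma post_fixpoint_iff_reject:
  assumes wf: "wf_tm M" and N: "length w + 1 < N" "n < N" and h: "halted M (run M w n)"
  shows "(\<exists>H. NRoot \<in> H \<and> (\<forall>n\<in>H. \<exists>n1\<in>H. \<exists>n2\<in>H. \<exists>n3\<in>H. [n, n1, n2, n3] \<in> rules M w N)) \<longleftrightarrow>
    cst (run M w n) \<noteq> acc M"
proof
  assume "\<exists>H. NRoot \<in> H \<and> (\<forall>n\<in>H. \<exists>n1\<in>H. \<exists>n2\<in>H. \<exists>n3\<in>H. [n, n1, n2, n3] \<in> rules M w N)"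
  then obtain H where H: "NRoot \<in> H" "\<And>n. n \<in> H \<Longrightarrow> \<exists>n1\<in>H. \<exists>n2\<in>H. \<exists>n3\<in>H. [n, n1, n2, n3] \<in> rules M w N"
    by blast
  from H(2)[OF H(1)] rules_NRoot obtain t i p where "NS (rej M) t i p \<in> H" by blast
  with post_fixpoint_sound(3)[of H M w N] H(2) have t: "cst (run M w t) = rej M" by metis
  then have "halted M (run M w t)" by (simp add: halted_def)
  \<comment> \<open>The rejecting time \<open>t\<close> need not be \<open>n\<close>, but both
    configurations are halted, so the earlier one persists until the later time.\<close>
  with halted_run_stays h have "run M w t = run M w n" by (metis nat_le_linear)
  with t wf show "cst (run M w n) \<noteq> acc M" by (simp add: wf_tm_def)
next
  assume "cst (run M w n) \<noteq> acc M"
  with h have "cst (run M w n) = rej M" by (simp add: halted_def)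
  with post_fixpoint_complete[OF wf N] show "\<exists>H. NRoot \<in> H \<and> (\<forall>n\<in>H. \<exists>n1\<in>H. \<exists>n2\<in>H. \<exists>n3\<in>H. [n, n1, n2, n3] \<in> rules M w N)"
    by blast
qed

subsection \<open>Machines that print a word per step\<close>

type_synonym 'q wdelta = "'q \<Rightarrow> isym \<Rightarrow> nat \<Rightarrow> 'q \<times> nat \<times> move \<times> move \<times> bool list"
type_synonym 'q wconfig = "'q \<times> nat \<times> nat \<times> (nat \<Rightarrow> nat)"

text \<open>The derivation carries the printed word and the space bound \<open>B\<close> but no step
  count, since \<open>logspace_computes\<close> restricts only the work head.\<close>

inductive reach :: "'q wdelta \<Rightarrow> 'q set \<Rightarrow> bool list \<Rightarrow> nat \<Rightarrow> 'q wconfig \<Rightarrow> bool list \<Rightarrow> 'q wconfig \<Rightarrow> bool"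
  for \<delta> F w B where
  reach_refl: "p \<le> B \<Longrightarrow> reach \<delta> F w B (q, i, p, T) [] (q, i, p, T)"
| reach_step: "\<lbrakk> p \<le> B; q \<notin> F; \<delta> q (input_sym w i) (T p) = (q', s', mi, mw, v);
    reach \<delta> F w B (q', min (Suc (length w)) (mv mi i), mv mw p, T(p := s')) v' c \<rbrakk>
    \<Longrightarrow> reach \<delta> F w B (q, i, p, T) (v @ v') c"

lemma reach_trans:
  "reach \<delta> F w B c v c' \<Longrightarrow> reach \<delta> F w B c' v' c'' \<Longrightarrow> reach \<delta> F w B c (v @ v') c''"
  by (induction rule: reach.induct) (auto intro: reach_step)

lemma reach_bound: "reach \<delta> F w B c v (q, i, p, T) \<Longrightarrow> p \<le> B"
  by (induction c v "(q, i, p, T)" rule: reach.induct) auto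

text \<open>A \<open>tm\<close> prints at most one bit per step, so a state carries a buffer of bits
  still to be printed.\<close>

definition word_tm :: "'q::countable wdelta \<Rightarrow> 'q set \<Rightarrow> nat set \<Rightarrow> nat \<Rightarrow> 'q \<Rightarrow> 'q \<Rightarrow> 'q \<Rightarrow> tm" where
  "word_tm \<delta> Q Y L qs qa qr =
    \<lparr>states = to_nat ` ({bs :: bool list. length bs \<le> L} \<times> Q), syms = Y,
     start = to_nat ([] :: bool list, qs), acc = to_nat ([] :: bool list, qa), rej = to_nat ([] :: bool list, qr),
     delta = (\<lambda>n a s. case (from_nat n :: bool list \<times> 'q) of
        (b # bs, q) \<Rightarrow> (to_nat (bs, q), s, MvS, MvS, Some b)
      | ([], q) \<Rightarrow> (case \<delta> q a s of (q', s', mi, mw, v) \<Rightarrow> (to_nat (v, q'), s', mi, mw, None)))\<rparr>"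

lemma wf_word_tm:
  assumes "finite Q" "finite Y" "0 \<in> Y" "{qs, qa, qr} \<subseteq> Q" "qa \<noteq> qr"
    and "\<And>q a s q' s' mi mw v. q \<in> Q \<Longrightarrow> s \<in> Y \<Longrightarrow> \<delta> q a s = (q', s', mi, mw, v) \<Longrightarrow>
      q' \<in> Q \<and> s' \<in> Y \<and> length v \<le> L"
  shows "wf_tm (word_tm \<delta> Q Y L qs qa qr)"
proof -
  have "finite {bs :: bool list. length bs \<le> L}"
    using finite_lists_length_le[of "UNIV :: bool set" L] by simp
  then show ?thesis
    using assms(1-5) unfolding wf_tm_def word_tm_def
    by (auto split: list.splits prod.splits dest: assms(6))
qed

definition word_config :: "(bool list \<times> 'q::countable) \<Rightarrow> nat \<Rightarrow> nat \<Rightarrow> (nat \<Rightarrow> nat) \<Rightarrow> bool list \<Rightarrow> config" where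
  "word_config q i p T x = \<lparr>cst = to_nat q, ipos = i, wpos = p, wtape = T, out = x\<rparr>"

lemma rtranclp_step_run:
  assumes "(\<lambda>c c'. c' = step M w c \<and> wpos c \<le> B)\<^sup>*\<^sup>* c c'" "wpos c' \<le> B"
  shows "\<exists>n. (step M w ^^ n) c = c' \<and> (\<forall>m\<le>n. wpos ((step M w ^^ m) c) \<le> B)"
  using assms(1)
proof (induction rule: converse_rtranclp_induct)
  case base
  then show ?case using assms(2) by (intro exI[of _ 0]) auto
next
  case (step c d)
  then obtain n where n: "(step M w ^^ n) d = c'" "\<forall>m\<le>n. wpos ((step M w ^^ m) d) \<le> B" by blast
  have "wpos ((step M w ^^ m) c) \<le> B" if "m \<le> Suc n" for m
    using that step n(2) by (cases m) (auto simp: funpow_swap1)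
  with n(1) step show ?case by (intro exI[of _ "Suc n"]) (auto simp: funpow_swap1)
qed

text \<open>An abstract step becomes one machine step that fills the buffer and one step per bit
  with resting heads. The buffer is emptied at the new head position, whose bound comes from the
  rest of the derivation.\<close>

lemma word_tm_reach:
  fixes \<delta> :: "'q::countable wdelta"
  assumes M_def: "M = word_tm \<delta> Q Y L qs qa qr"
    and "reach \<delta> {qa, qr} w B (q, i, p, T) v (q', i', p', T')" "i \<le> Suc (length w)"
  shows "(\<lambda>c c'. c' = step M w c \<and> wpos c \<le> B)\<^sup>*\<^sup>*
    (word_config ([], q) i p T x) (word_config ([], q') i' p' T' (x @ v))"
  using assms(2,3)
proof (induction "(q, i, p, T)" v "(q', i', p', T')" arbitrary: q i p T x rule: reach.induct)
  case reach_refl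
  then show ?case by simp
next
  case (reach_step p q i T q1 s1 mi mw v v')
  let ?R = "\<lambda>c c'. c' = step M w c \<and> wpos c \<le> B"
  let ?i = "min (Suc (length w)) (mv mi i)" and ?p = "mv mw p" and ?T = "T(p := s1)"
  have 1: "?R (word_config ([], q) i p T x) (word_config (v, q1) ?i ?p ?T x)"
    using reach_step(1-3)
    by (auto simp: step_def halted_def M_def word_tm_def word_config_def)
  have pB: "?p \<le> B" using reach_step(4) by (cases rule: reach.cases) auto
  have "?R\<^sup>*\<^sup>* (word_config (v, q1) ?i ?p ?T x) (word_config ([], q1) ?i ?p ?T (x @ v))"
  proof (induction v arbitrary: x)
    case (Cons b v)
    have "?R (word_config (b # v, q1) ?i ?p ?T x) (word_config (v, q1) ?i ?p ?T (x @ [b]))"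
      using pB by (auto simp: step_def halted_def M_def word_tm_def word_config_def)
    from converse_rtranclp_into_rtranclp[where r = ?R, OF this Cons[of "x @ [b]"]]
    show ?case by (simp only: append_assoc append.simps)
  qed simp
  also have "?R\<^sup>*\<^sup>* (word_config ([], q1) ?i ?p ?T (x @ v)) (word_config ([], q') i' p' T' ((x @ v) @ v'))"
    by (rule reach_step(5)) simp
  finally have "?R\<^sup>*\<^sup>* (word_config (v, q1) ?i ?p ?T x) (word_config ([], q') i' p' T' (x @ v @ v'))"
    by (simp only: append_assoc)
  with 1 show ?case by (rule converse_rtranclp_into_rtranclp[where r = ?R])
qed

lemma finite_UNIV_isym: "finite (UNIV :: isym set)"
proof -
  have "UNIV \<subseteq> insert LEnd (insert REnd (Bit ` UNIV))"
  proof
    fix a show "a \<in> insert LEnd (insert REnd (Bit ` UNIV))" by (cases a) auto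
  qed
  then show ?thesis by (rule finite_subset) simp
qed

lemma logspace_computes_word:
  fixes \<delta> :: "'q::countable wdelta"
  assumes fin: "finite Q" "finite Y" and mem: "0 \<in> Y" "{qs, qa, qr} \<subseteq> Q" "qa \<noteq> qr"
    and closed: "\<And>q a s q' s' mi mw v. q \<in> Q \<Longrightarrow> s \<in> Y \<Longrightarrow> \<delta> q a s = (q', s', mi, mw, v) \<Longrightarrow> q' \<in> Q \<and> s' \<in> Y"
    and reach: "\<And>w. \<exists>i p T. reach \<delta> {qa, qr} w (B w) (qs, 0, 0, \<lambda>_. 0) (f w) (qa, i, p, T)"
    and bound: "\<And>w. real (B w) \<le> real k * log 2 (real (length w + 2))"
  shows "\<exists>M. logspace_computes M f"
proof -
  \<comment> \<open>There are finitely many transitions, so the longest word that one of them prints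
    bounds the buffer.\<close>
  define Ls where "Ls = (\<lambda>(q, a, s). length (snd (snd (snd (snd (\<delta> q a s)))))) ` (Q \<times> UNIV \<times> Y)"
  have "finite Ls" unfolding Ls_def using fin finite_UNIV_isym by blast
  have L: "length v \<le> Max Ls" if "q \<in> Q" "s \<in> Y" "\<delta> q a s = (q', s', mi, mw, v)" for q a s q' s' mi mw v
  proof (rule Max_ge[OF \<open>finite Ls\<close>])
    show "length v \<in> Ls" unfolding Ls_def using that by (auto intro!: image_eqI[of _ _ "(q, a, s)"])
  qed
  define M where "M = word_tm \<delta> Q Y (Max Ls) qs qa qr"
  have "wf_tm M" unfolding M_def
    by (rule wf_word_tm[OF fin mem]) (use L closed in blast)
  moreover have "\<exists>n. halted M (run M w n) \<and> out (run M w n) = f w \<and>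
      (\<forall>m\<le>n. real (wpos (run M w m)) \<le> real k * log 2 (real (length w + 2)))" for w
  proof -
    obtain i p T where r: "reach \<delta> {qa, qr} w (B w) (qs, 0, 0, \<lambda>_. 0) (f w) (qa, i, p, T)"
      using reach by blast
    have "wpos (word_config ([], qa) i p T (f w)) \<le> B w"
      using reach_bound[OF r] by (simp add: word_config_def)
    note le = this
    have "(\<lambda>c c'. c' = step M w c \<and> wpos c \<le> B w)\<^sup>*\<^sup>*
        (word_config ([], qs) 0 0 (\<lambda>_. 0) []) (word_config ([], qa) i p T (f w))"
      using word_tm_reach[OF M_def r, of "[]"] by simp
    from rtranclp_step_run[OF this le]
    obtain n where n: "(step M w ^^ n) (word_config ([], qs) 0 0 (\<lambda>_. 0) []) = word_config ([], qa) i p T (f w)"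
      "\<And>m. m \<le> n \<Longrightarrow> wpos ((step M w ^^ m) (word_config ([], qs) 0 0 (\<lambda>_. 0) [])) \<le> B w"
      by blast
    have "init M = word_config ([], qs) 0 0 (\<lambda>_. 0) []"
      by (simp add: init_def M_def word_tm_def word_config_def)
    then have run: "run M w m = (step M w ^^ m) (word_config ([], qs) 0 0 (\<lambda>_. 0) [])" for m
      by (simp add: run_def)
    have "real (wpos (run M w m)) \<le> real k * log 2 (real (length w + 2))" if "m \<le> n" for m
      using n(2)[OF that] bound[of w] unfolding run by linarith
    moreover have "halted M (run M w n)" "out (run M w n) = f w"
      unfolding run n(1) by (simp_all add: halted_def M_def word_tm_def word_config_def)
    ultimately show ?thesis by blast
  qed
  ultimately show ?thesis unfolding logspace_computes_def by blast
qed

subsection \<open>Positional notation\<close>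

text \<open>Least significant digit first; a carry out of the word lengthens it.\<close>

fun inc :: "nat \<Rightarrow> nat list \<Rightarrow> nat list" where
  "inc \<beta> [] = [1]"
| "inc \<beta> (d # u) = (if Suc d < \<beta> then Suc d # u else 0 # inc \<beta> u)"

fun digs :: "nat \<Rightarrow> nat \<Rightarrow> nat \<Rightarrow> nat list" where
  "digs \<beta> 0 j = []"
| "digs \<beta> (Suc m) j = (j mod \<beta>) # digs \<beta> m (j div \<beta>)"

lemma length_digs [simp]: "length (digs \<beta> m j) = m"
  by (induction m arbitrary: j) auto

lemma set_digs: "0 < \<beta> \<Longrightarrow> set (digs \<beta> m j) \<subseteq> {..<\<beta>}"
  by (induction m arbitrary: j) auto

lemma digs_0: "digs \<beta> m 0 = replicate m 0"
  by (induction m) auto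

lemma set_inc: "2 \<le> \<beta> \<Longrightarrow> set u \<subseteq> {..<\<beta>} \<Longrightarrow> set (inc \<beta> u) \<subseteq> {..<\<beta>}"
  by (induction u) auto

lemma length_inc: "length u \<le> length (inc \<beta> u)"
  by (induction u) auto

text \<open>The first conjunct provides the digit that absorbs the carry; the last phase of the
  machine continues exactly as long as there is one.\<close>

lemma inc_digs:
  assumes "2 \<le> \<beta>" "Suc j < \<beta> ^ m"
  shows "(\<exists>d\<in>set (digs \<beta> m j). Suc d < \<beta>) \<and> inc \<beta> (digs \<beta> m j) = digs \<beta> m (Suc j)"
  using assms
proof (induction m arbitrary: j)
  case (Suc m)
  show ?case
  proof (cases "Suc (j mod \<beta>) < \<beta>")
    case True
    then have "Suc j mod \<beta> = Suc (j mod \<beta>)" "Suc j div \<beta> = j div \<beta>"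
      by (simp_all add: mod_Suc div_Suc)
    with True show ?thesis by simp
  next
    case False
    then have e: "Suc (j mod \<beta>) = \<beta>" using Suc.prems(1) mod_less_divisor[of \<beta> j] by linarith
    then have "Suc j mod \<beta> = 0" "Suc j div \<beta> = Suc (j div \<beta>)"
      by (simp_all add: mod_Suc div_Suc)
    moreover have "Suc (j div \<beta>) < \<beta> ^ m"
    proof -
      have "\<beta> * Suc (j div \<beta>) = Suc j" using e by (metis add_Suc_right mult_Suc_right mult_div_mod_eq add.commute)
      then have "\<beta> * Suc (j div \<beta>) < \<beta> * \<beta> ^ m" using Suc.prems(2) by simp
      then show ?thesis using mult_less_cancel1 by blast
    qed
    ultimately show ?thesis using Suc.IH[of "j div \<beta>"] Suc.prems(1) False by simp
  qed
qed simp

lemma digs_last: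
  assumes "2 \<le> \<beta>" "Suc j = \<beta> ^ m" "d \<in> set (digs \<beta> m j)"
  shows "\<not> Suc d < \<beta>"
  using assms(2,3)
proof (induction m arbitrary: j)
  case (Suc m)
  then have j: "Suc j = \<beta> * \<beta> ^ m" by simp
  then have "Suc j mod \<beta> = 0" by simp
  then have e: "Suc (j mod \<beta>) = \<beta>" by (auto simp: mod_Suc split: if_splits)
  then have "\<beta> * Suc (j div \<beta>) = \<beta> * \<beta> ^ m"
    using j by (metis add_Suc_right mult_Suc_right mult_div_mod_eq add.commute)
  then have "Suc (j div \<beta>) = \<beta> ^ m" using assms(1) by (simp only: mult_cancel1) auto
  with Suc e show ?case by auto
qed simp

lemma digs_surj:
  "set v \<subseteq> {..<\<beta>} \<Longrightarrow> \<exists>j<\<beta> ^ length v. digs \<beta> (length v) j = v"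
proof (induction v)
  case (Cons d v)
  then obtain j where j: "j < \<beta> ^ length v" "digs \<beta> (length v) j = v" by auto
  have d: "d < \<beta>" using Cons.prems by simp
  have "d + \<beta> * j < \<beta> * \<beta> ^ length v"
  proof -
    have "\<beta> * Suc j \<le> \<beta> * \<beta> ^ length v" using j(1) by (intro mult_le_mono2) simp
    with d show ?thesis by simp
  qed
  with d j(2) show ?case by (intro exI[of _ "d + \<beta> * j"]) auto
qed simp

fun num2 :: "nat list \<Rightarrow> nat" where
  "num2 [] = 0"
| "num2 (d # u) = d + 2 * num2 u"

lemma num2_less: "set u \<subseteq> {..<2} \<Longrightarrow> num2 u < 2 ^ length u"
  by (induction u) auto

lemma num2_inc: "set u \<subseteq> {..<2} \<Longrightarrow> num2 (inc 2 u) = Suc (num2 u)"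
  by (induction u) auto

lemma length_inc2:
  "set u \<subseteq> {..<2} \<Longrightarrow> length (inc 2 u) = length u \<or>
     length (inc 2 u) = Suc (length u) \<and> 2 ^ length u = Suc (num2 u)"
  by (induction u) auto

text \<open>Counting from the empty word creates no leading zeros, because a word is lengthened only
  when it consists of ones. Its length is therefore logarithmic; the \<open>+ 1\<close> serves
  \<open>j = 0\<close>, where the word is empty.\<close>

lemma count2:
  defines "v \<equiv> \<lambda>j. (inc 2 ^^ j) []"
  shows "set (v j) \<subseteq> {..<2} \<and> num2 (v j) = j \<and> 2 ^ length (v j) \<le> 2 * j + 1"
proof (induction j)
  case 0
  then show ?case by (simp add: v_def)
next
  case (Suc j)
  have S: "v (Suc j) = inc 2 (v j)" by (simp add: v_def)
  have "2 ^ length (inc 2 (v j)) \<le> 2 * Suc j + 1"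
    using length_inc2[of "v j"] Suc by auto
  with Suc show ?case unfolding S using num2_inc set_inc[of 2] by simp
qed

subsection \<open>A machine printing all instances of finitely many templates\<close>

text \<open>The word printed when leaving the mark, the fields printed along the tape, and the word
  printed on the blank behind it.\<close>

type_synonym pass = "bool list \<times> field list \<times> bool list"

text \<open>\<open>Go\<close> returns to the mark and starts the next pending pass;
  \<open>Run\<close> performs a pass, its field list holding the current carries. \<open>Inc\<close>
  increments the word and \<open>Ret\<close> goes back to the mark. Between phases
  \<open>Clr\<close> zeroes the word and \<open>Rew\<close> rewinds the input.\<close>

datatype st = Boot | Start nat | Go nat "pass list" | Run nat "pass list" "field list" "bool list"
  | Inc nat | Ret nat | Clr nat | Rew nat | Acc | Rej

instance st :: countable
  by countable_datatype

text \<open>A prefix-free code: digits printed one after another can still be told apart.\<close>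

definition unary :: "nat \<Rightarrow> bool list" where
  "unary n = replicate n True @ [False]"

definition bits_out :: "bool list \<Rightarrow> bool list" where
  "bits_out bs = concat (map (\<lambda>b. tok_bits (bit_tok b)) bs)"

lemma bits_out_append [simp]: "bits_out (xs @ ys) = bits_out xs @ bits_out ys"
  by (simp add: bits_out_def)

text \<open>Phase 0 counts the input positions in binary to mark off a logarithmic number of cells, phase 1
  counts them again in base \<open>b\<close>, phase 2 runs through all words of that length over the digits below
  \<open>b ^ 4\<close>, each such digit holding one base \<open>b\<close> digit of each of four tracks. Cell 0 holds a mark
  and a digit \<open>d\<close> is stored as \<open>d + 1\<close>. For every word the machine makes the passes
  \<open>pl ph a\<close> (\<open>a\<close> being the scanned input symbol), printing for each field \<open>(r, c)\<close> the digits of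
  track \<open>r\<close> plus \<open>c\<close>, least significant first, with \<open>c\<close> serving as the carry.\<close>

locale enumerator =
  fixes b :: nat and pl :: "nat \<Rightarrow> isym \<Rightarrow> pass list" and fin :: "bool list"
  assumes b2: "2 \<le> b"
    and pl_ok: "\<And>ph a pre fs post. (pre, fs, post) \<in> set (pl ph a) \<Longrightarrow> set fs \<subseteq> {..4} \<times> {..1} \<and> length fs \<le> 3"
    and pl0: "pl 0 a = []"
begin

definition dig :: "nat \<Rightarrow> nat \<Rightarrow> nat" where "dig r d = d div b ^ r mod b"

text \<open>A digit below \<open>b\<close> is its own track 0, so the words of phase 1 are printed
  by the same routine as those of phase 2.\<close>

definition base :: "nat \<Rightarrow> nat" where
  "base ph = (if ph = 0 then 2 else if ph = 1 then b else b ^ 4)"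

text \<open>Stored digits occupy \<open>1\<close> to \<open>b ^ 4\<close> and the blank is
  \<open>0\<close>; this is the next free symbol.\<close>

definition mark :: nat where "mark = Suc (b ^ 4)"

definition adv :: "nat \<Rightarrow> field \<Rightarrow> field" where
  "adv d = (\<lambda>(r, c). (r, (dig r d + c) div b))"

definition field_out :: "nat \<Rightarrow> field \<Rightarrow> bool list" where
  "field_out d = (\<lambda>(r, c). unary ((dig r d + c) mod b))"

text \<open>A stored symbol is a digit plus one, so the test \<open>s < base ph\<close> in
  \<open>Inc\<close> asks whether the carry stops here. On a blank, \<open>Inc\<close> appends the
  digit 1 (stored as 2) in phases 0 and 1, whereas in phase 2 the lost carry ends the
  computation.\<close>

fun \<delta> :: "st wdelta" where
  "\<delta> Boot a s = (Start 0, mark, MvS, MvS, [])"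
| "\<delta> (Start ph) a s = (Go ph (pl ph a), s, MvS, MvS, [])"
| "\<delta> (Go ph ms) a s = (if s \<noteq> mark then (Go ph ms, s, MvS, MvL, []) else
     case ms of [] \<Rightarrow> (Inc ph, s, MvS, MvR, [])
     | (pre, fs, post) # ms' \<Rightarrow> (Run ph ms' fs post, s, MvS, MvR, pre))"
| "\<delta> (Run ph ms fs post) a s =
     (if s = 0 then (Go ph ms, s, MvS, MvL, bits_out (concat (map (\<lambda>(r, c). unary c) fs)) @ post)
      else (Run ph ms (map (adv (s - 1)) fs) post, s, MvS, MvR, bits_out (concat (map (field_out (s - 1)) fs))))"
| "\<delta> (Inc ph) a s =
     (if s = 0 then if ph = 2 then (Acc, s, MvS, MvS, fin) else (Ret ph, 2, MvS, MvL, [])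
      else if s < base ph then (Ret ph, Suc s, MvS, MvL, []) else (Inc ph, 1, MvS, MvR, []))"
| "\<delta> (Ret ph) a s = (if s \<noteq> mark then (Ret ph, s, MvS, MvL, [])
     else if ph = 2 then (Start ph, s, MvS, MvS, [])
     else if a = REnd then (Clr (Suc ph), s, MvS, MvR, []) else (Start ph, s, MvR, MvS, []))"
| "\<delta> (Clr ph) a s = (if s = 0 then (Rew ph, s, MvS, MvL, []) else (Clr ph, 1, MvS, MvR, []))"
| "\<delta> (Rew ph) a s = (if s \<noteq> mark then (Rew ph, s, MvS, MvL, [])
     else if a = LEnd then (Start ph, s, MvS, MvS, []) else (Rew ph, s, MvL, MvS, []))"
| "\<delta> Acc a s = (Acc, s, MvS, MvS, [])"
| "\<delta> Rej a s = (Rej, s, MvS, MvS, [])"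

definition remaining :: "pass list set" where
  "remaining = (\<Union>ph\<in>{..2}. \<Union>a. (\<lambda>k. drop k (pl ph a)) ` {..length (pl ph a)})"

definition posts :: "bool list set" where
  "posts = (\<Union>ph\<in>{..2}. \<Union>a. (snd \<circ> snd) ` set (pl ph a))"

definition Q :: "st set" where
  "Q = {Boot, Acc, Rej} \<union> (\<Union>ph\<in>{..2}. {Start ph, Inc ph, Ret ph, Clr ph, Rew ph})
     \<union> (\<lambda>(ph, ms). Go ph ms) ` ({..2} \<times> remaining)
     \<union> (\<lambda>(ph, ms, fs, post). Run ph ms fs post) `
         ({..2} \<times> remaining \<times> {fs. set fs \<subseteq> {..4} \<times> {..1} \<and> length fs \<le> 3} \<times> posts)"

lemma Go_in_Q: "Go ph ms \<in> Q \<longleftrightarrow> ph \<le> 2 \<and> ms \<in> remaining"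
  by (auto simp: Q_def image_iff)

lemma Run_in_Q: "Run ph ms fs post \<in> Q \<longleftrightarrow>
    ph \<le> 2 \<and> ms \<in> remaining \<and> set fs \<subseteq> {..4} \<times> {..1} \<and> length fs \<le> 3 \<and> post \<in> posts"
  by (auto simp: Q_def image_iff)

lemma finite_Q: "finite Q"
proof -
  have "finite remaining" "finite posts"
    unfolding remaining_def posts_def using finite_UNIV_isym by blast+
  moreover have "finite {fs :: field list. set fs \<subseteq> {..4} \<times> {..1} \<and> length fs \<le> 3}"
    by (rule finite_lists_length_le) simp
  ultimately show ?thesis unfolding Q_def by auto
qed

lemma remaining_Cons:
  assumes "m # ms \<in> remaining"
  shows "ms \<in> remaining \<and> (\<exists>ph\<in>{..2}. \<exists>a. m \<in> set (pl ph a))"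
proof -
  obtain ph a k where k: "ph \<in> {..2}" "k \<le> length (pl ph a)" "m # ms = drop k (pl ph a)"
    using assms unfolding remaining_def by auto
  then have "k < length (pl ph a)" by (metis drop_all leI list.distinct(1))
  moreover from this k(3) have "ms = drop (Suc k) (pl ph a)" by (metis drop_Suc list.sel(3) tl_drop)
  moreover have "m \<in> set (pl ph a)" using k(3) by (metis in_set_dropD list.set_intros(1))
  ultimately show ?thesis using k(1) unfolding remaining_def by (metis (no_types, lifting) Suc_leI UNIV_I UN_I atMost_iff imageI)
qed

lemma \<delta>_closed:
  assumes "q \<in> Q" "s \<in> {..mark}" "\<delta> q a s = (q', s', mi, mw, v)"
  shows "q' \<in> Q \<and> s' \<in> {..mark}"
proof -
  have "b ^ 1 \<le> b ^ 4" using b2 by (intro power_increasing) auto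
  then have b: "b \<le> b ^ 4" by simp
  have m: "1 \<in> {..mark}" "2 \<in> {..mark}" "mark \<in> {..mark}" "base ph < mark" for ph
    using b b2 by (auto simp: mark_def base_def)
  have start: "Go ph (pl ph a) \<in> Q" if "ph \<le> 2" for ph
  proof -
    have "pl ph a \<in> remaining" unfolding remaining_def using that by (auto intro!: bexI[of _ ph] exI[of _ a] image_eqI[of _ _ 0])
    then show ?thesis using that by (simp add: Go_in_Q)
  qed
  have adv: "set (map (adv d) fs) \<subseteq> {..4} \<times> {..1}" if "set fs \<subseteq> {..4} \<times> {..1}" for d fs
  proof -
    \<comment> \<open>A digit is at most \<open>b - 1\<close>, so adding a carry of at most 1
      produces a carry of at most 1. Hence finitely many field lists occur in the control.\<close>
    have carry: "(dig r d + c) div b \<le> 1" if "c \<le> 1" for r c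
    proof -
      have "dig r d + c \<le> b" using that b2 mod_less_divisor[of b "d div b ^ r"] unfolding dig_def by linarith
      then show ?thesis using b2 by (metis div_le_mono div_self not_numeral_le_zero)
    qed
    show ?thesis
    proof
      fix x assume "x \<in> set (map (adv d) fs)"
      then obtain r c where rc: "(r, c) \<in> set fs" "x = (r, (dig r d + c) div b)" by (auto simp: adv_def)
      with that have "r \<le> 4" "c \<le> 1" by auto
      with carry[of c r] rc(2) show "x \<in> {..4} \<times> {..1}" by simp
    qed
  qed
  show ?thesis
  proof (cases q)
    case (Go ph ms)
    with assms(1) have q: "ph \<le> 2" "ms \<in> remaining" by (auto simp: Go_in_Q)
    show ?thesis
    proof (cases "s = mark \<and> ms \<noteq> []")
      case True
      then obtain pre fs post ms' where ms: "ms = (pre, fs, post) # ms'" by (metis list.exhaust prod_cases3)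
      from remaining_Cons[of "(pre, fs, post)" ms'] q ms obtain ph' a' where
        r: "ms' \<in> remaining" "ph' \<le> 2" "(pre, fs, post) \<in> set (pl ph' a')" by auto
      then have "post \<in> posts" unfolding posts_def by force
      with r q pl_ok[OF r(3)] have "Run ph ms' fs post \<in> Q" by (simp add: Run_in_Q)
      then show ?thesis using assms(2,3) True Go ms by auto
    next
      case False
      then have "q' \<in> {q, Inc ph}" "s' = s" using assms(3) Go by (auto split: if_splits list.splits)
      moreover have "Inc ph \<in> Q" using q by (auto simp: Q_def)
      ultimately show ?thesis using assms(1,2) by auto
    qed
  next
    case (Run ph ms fs post)
    with assms(1) have q: "ph \<le> 2" "ms \<in> remaining" "set fs \<subseteq> {..4} \<times> {..1}" "length fs \<le> 3" "post \<in> posts"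
      by (auto simp: Run_in_Q)
    then have "Go ph ms \<in> Q" "Run ph ms (map (adv d) fs) post \<in> Q" for d
      using adv[OF q(3), of d] by (simp_all add: Go_in_Q Run_in_Q)
    then show ?thesis using assms(2,3) Run by (auto split: if_splits)
  next
    case (Start ph)
    with assms(1) have "ph \<le> 2" by (auto simp: Q_def)
    with assms(2,3) start Start show ?thesis by auto
  next
    case (Inc ph)
    with assms m(1-3) m(4)[of ph] show ?thesis by (auto simp: Q_def split: if_splits)
  next
    case (Ret ph)
    with assms m(1-3) m(4)[of ph] show ?thesis by (auto simp: Q_def split: if_splits)
  next
    case (Clr ph)
    with assms m(1-3) m(4)[of ph] show ?thesis by (auto simp: Q_def split: if_splits)
  next
    case (Rew ph)
    with assms m(1-3) m(4)[of ph] show ?thesis by (auto simp: Q_def split: if_splits)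
  qed (use assms m in \<open>auto simp: Q_def\<close>)
qed

section \<open>Tape layout and subroutines of the printing machine\<close>

definition tp :: "nat list \<Rightarrow> nat \<Rightarrow> nat" where
  "tp u j = (if j = 0 then mark else if j \<le> length u then Suc (u ! (j - 1)) else 0)"

lemma tp_0 [simp]: "tp u 0 = mark"
  by (simp add: tp_def)

lemma tp_mid [simp]: "tp (xs @ d # ys) (Suc (length xs)) = Suc d"
  by (simp add: tp_def)

lemma tp_end [simp]: "tp u (Suc (length u)) = 0"
  by (simp add: tp_def)

lemma tp_upd: "(tp (xs @ d # ys))(Suc (length xs) := Suc e) = tp (xs @ e # ys)"
  by (auto simp: fun_eq_iff tp_def nth_append nth_Cons split: nat.splits)

lemma tp_upd_end: "(tp u)(Suc (length u) := Suc e) = tp (u @ [e])"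
  by (auto simp: fun_eq_iff tp_def nth_append)

lemma tp_neq_mark:
  assumes "set u \<subseteq> {..<b ^ 4}" "0 < p"
  shows "tp u p \<noteq> mark"
proof (cases "p \<le> length u")
  case True
  then have "u ! (p - 1) < b ^ 4" using assms by (meson diff_less less_le_trans nth_mem subsetD lessThan_iff zero_less_one)
  with True assms show ?thesis by (simp add: tp_def mark_def)
next
  case False
  with assms show ?thesis by (simp add: tp_def mark_def)
qed

abbreviation rch :: "bool list \<Rightarrow> nat \<Rightarrow> st wconfig \<Rightarrow> bool list \<Rightarrow> st wconfig \<Rightarrow> bool" where
  "rch \<equiv> reach \<delta> {Acc, Rej}"

lemma rch_step:
  assumes "p \<le> B" "q \<notin> {Acc, Rej}" "\<delta> q (input_sym w i) (T p) = (q', s', mi, mw, v)"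
    and "rch w B (q', i', p', T') v' c"
    and "i' = min (Suc (length w)) (mv mi i)" "p' = mv mw p" "T' = T(p := s')" "v'' = v @ v'"
  shows "rch w B (q, i, p, T) v'' c"
  using assms by (auto intro: reach_step)

text \<open>The final configuration is matched by an equation, because in inductions along the word
  it agrees only up to reassociating appends.\<close>

lemma rch_step_cong:
  assumes "p \<le> B" "q \<notin> {Acc, Rej}" "\<delta> q (input_sym w i) (T p) = (q', s', mi, mw, v)"
    and "rch w B (q', i', p', T') v' c'"
    and "i' = min (Suc (length w)) (mv mi i)" "p' = mv mw p" "T' = T(p := s')" "v'' = v @ v'" "c = c'"
  shows "rch w B (q, i, p, T) v'' c"
  using assms rch_step by blast

lemma rch_left:
  assumes "q \<notin> {Acc, Rej}" "\<And>a s. s \<noteq> mark \<Longrightarrow> \<delta> q a s = (q, s, MvS, MvL, [])"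
    and "set u \<subseteq> {..<b ^ 4}" "p \<le> B" "i \<le> Suc (length w)"
  shows "rch w B (q, i, p, tp u) [] (q, i, 0, tp u)"
  using assms(4)
proof (induction p)
  case 0
  then show ?case by (simp add: reach_refl)
next
  case (Suc p)
  show ?case
    by (rule rch_step[OF Suc.prems assms(1) assms(2)[OF tp_neq_mark[OF assms(3)]] Suc.IH])
       (use Suc.prems assms(5) in auto)
qed

fun read_out :: "field list \<Rightarrow> nat list \<Rightarrow> bool list" where
  "read_out fs [] = concat (map (\<lambda>(r, c). unary c) fs)"
| "read_out fs (d # u) = concat (map (field_out d) fs) @ read_out (map (adv d) fs) u"

lemma rch_run:
  assumes "length (xs @ ys) < B" "i \<le> Suc (length w)"
  shows "rch w B (Run ph ms fs post, i, Suc (length xs), tp (xs @ ys)) (bits_out (read_out fs ys) @ post)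
     (Go ph ms, i, length (xs @ ys), tp (xs @ ys))"
  using assms(1)
proof (induction ys arbitrary: xs fs)
  case Nil
  show ?case
    by (rule rch_step[OF _ _ _ reach_refl]) (use Nil assms(2) in auto)
next
  case (Cons d ys)
  show ?case
    by (rule rch_step_cong[OF _ _ _ Cons.IH[of "xs @ [d]" "map (adv d) fs"]]) (use Cons.prems assms(2) in auto)
qed

definition pass_out :: "nat list \<Rightarrow> pass \<Rightarrow> bool list" where
  "pass_out u = (\<lambda>(pre, fs, post). pre @ bits_out (read_out fs u) @ post)"

lemma rch_go:
  assumes "length u < B" "i \<le> Suc (length w)" "set u \<subseteq> {..<b ^ 4}" "p \<le> B"
  shows "rch w B (Go ph ms, i, p, tp u) (concat (map (pass_out u) ms)) (Inc ph, i, 1, tp u)"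
  using assms(4)
proof (induction ms arbitrary: p)
  case Nil
  have "rch w B (Go ph [], i, p, tp u) [] (Go ph [], i, 0, tp u)"
    by (rule rch_left) (use Nil assms in auto)
  moreover have "rch w B (Go ph [], i, 0, tp u) [] (Inc ph, i, 1, tp u)"
    by (rule rch_step[OF _ _ _ reach_refl]) (use assms in auto)
  ultimately show ?case using reach_trans by fastforce
next
  case (Cons m ms)
  obtain pre fs post where m: "m = (pre, fs, post)" by (cases m)
  have 1: "rch w B (Go ph (m # ms), i, p, tp u) [] (Go ph (m # ms), i, 0, tp u)"
    by (rule rch_left) (use Cons.prems assms in auto)
  have 2: "rch w B (Go ph (m # ms), i, 0, tp u) (pass_out u m) (Go ph ms, i, length u, tp u)"
    by (rule rch_step[OF _ _ _ rch_run[of "[]" u, simplified]]) (use assms in \<open>auto simp: m pass_out_def\<close>)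
  have 3: "rch w B (Go ph ms, i, length u, tp u) (concat (map (pass_out u) ms)) (Inc ph, i, 1, tp u)"
    by (rule Cons.IH) (use assms in simp)
  from reach_trans[OF 1 reach_trans[OF 2 3]] show ?case by simp
qed

text \<open>The strict length bound leaves room for the head on the first blank, where a carry out
  of the word arrives.\<close>

lemma rch_inc:
  assumes "length (xs @ ys) < B" "i \<le> Suc (length w)" "ph \<noteq> 2 \<or> (\<exists>d\<in>set ys. Suc d < base ph)"
  shows "\<exists>p\<le>B. rch w B (Inc ph, i, Suc (length xs), tp (xs @ ys)) [] (Ret ph, i, p, tp (xs @ inc (base ph) ys))"
  using assms(1,3)
proof (induction ys arbitrary: xs)
  case Nil
  have "rch w B (Inc ph, i, Suc (length xs), tp (xs @ [])) [] (Ret ph, i, length xs, tp (xs @ inc (base ph) []))"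
    by (rule rch_step[OF _ _ _ reach_refl]) (use Nil assms(2) tp_upd_end[of xs 1] in \<open>auto simp: numeral_2_eq_2\<close>)
  then show ?case using Nil.prems by (intro exI[of _ "length xs"]) auto
next
  case (Cons d ys)
  show ?case
  proof (cases "Suc d < base ph")
    case True
    have "rch w B (Inc ph, i, Suc (length xs), tp (xs @ d # ys)) [] (Ret ph, i, length xs, tp (xs @ inc (base ph) (d # ys)))"
      by (rule rch_step[OF _ _ _ reach_refl]) (use Cons.prems assms(2) tp_upd True in auto)
    then show ?thesis using Cons.prems by (intro exI[of _ "length xs"]) auto
  next
    case False
    then obtain p where p: "p \<le> B"
      "rch w B (Inc ph, i, Suc (length (xs @ [0])), tp ((xs @ [0]) @ ys)) [] (Ret ph, i, p, tp ((xs @ [0]) @ inc (base ph) ys))"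
      using Cons.IH[of "xs @ [0]"] Cons.prems by auto
    have "rch w B (Inc ph, i, Suc (length xs), tp (xs @ d # ys)) [] (Ret ph, i, p, tp (xs @ inc (base ph) (d # ys)))"
      by (rule rch_step_cong[OF _ _ _ p(2)])
         (use Cons.prems assms(2) tp_upd[of xs d ys 0] False in auto)
    with p show ?thesis by blast
  qed
qed

lemma rch_overflow:
  assumes "length (xs @ ys) < B" "i \<le> Suc (length w)" "\<forall>d\<in>set ys. \<not> Suc d < base 2"
  shows "\<exists>p T. rch w B (Inc 2, i, Suc (length xs), tp (xs @ ys)) fin (Acc, i, p, T)"
  using assms(1,3)
proof (induction ys arbitrary: xs)
  case Nil
  have "rch w B (Inc 2, i, Suc (length xs), tp (xs @ [])) fin (Acc, i, Suc (length xs), tp xs)"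
    by (rule rch_step[OF _ _ _ reach_refl]) (use Nil assms(2) in \<open>auto simp: fun_upd_idem\<close>)
  then show ?case by blast
next
  case (Cons d ys)
  then obtain p T where p: "rch w B (Inc 2, i, Suc (length (xs @ [0])), tp ((xs @ [0]) @ ys)) fin (Acc, i, p, T)"
    using Cons.IH[of "xs @ [0]"] by auto
  have "rch w B (Inc 2, i, Suc (length xs), tp (xs @ d # ys)) fin (Acc, i, p, T)"
    by (rule rch_step_cong[OF _ _ _ p(1)]) (use Cons.prems assms(2) tp_upd[of xs d ys 0] in auto)
  then show ?case by blast
qed

lemma rch_clr:
  assumes "length (xs @ ys) < B" "i \<le> Suc (length w)"
  shows "rch w B (Clr ph, i, Suc (length xs), tp (xs @ ys)) []
     (Rew ph, i, length (xs @ ys), tp (xs @ replicate (length ys) 0))"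
  using assms(1)
proof (induction ys arbitrary: xs)
  case Nil
  show ?case
    by (rule rch_step[OF _ _ _ reach_refl]) (use Nil assms(2) in \<open>auto simp: fun_upd_idem\<close>)
next
  case (Cons d ys)
  show ?case
    by (rule rch_step_cong[OF _ _ _ Cons.IH[of "xs @ [0]"]])
       (use Cons.prems assms(2) tp_upd[of xs d ys 0] in auto)
qed

lemma rch_rew:
  assumes "i \<le> Suc (length w)"
  shows "rch w B (Rew ph, i, 0, tp u) [] (Start ph, 0, 0, tp u)"
  using assms
proof (induction i)
  case 0
  show ?case
    by (rule rch_step[OF _ _ _ reach_refl]) (auto simp: input_sym_def fun_upd_idem)
next
  case (Suc i)
  show ?case
    by (rule rch_step[OF _ _ _ Suc.IH]) (use Suc.prems in \<open>auto simp: input_sym_def fun_upd_idem\<close>)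
qed

lemma rch_start:
  assumes "length u < B" "i \<le> Suc (length w)" "set u \<subseteq> {..<b ^ 4}"
  shows "rch w B (Start ph, i, 0, tp u) (concat (map (pass_out u) (pl ph (input_sym w i)))) (Inc ph, i, 1, tp u)"
  by (rule rch_step[OF _ _ _ rch_go]) (use assms in \<open>auto simp: fun_upd_idem\<close>)

lemma rch_round:
  assumes "length u < B" "i \<le> Suc (length w)" "set u \<subseteq> {..<b ^ 4}" "set (inc (base ph) u) \<subseteq> {..<b ^ 4}"
    and "ph \<noteq> 2 \<or> (\<exists>d\<in>set u. Suc d < base ph)"
  shows "rch w B (Start ph, i, 0, tp u) (concat (map (pass_out u) (pl ph (input_sym w i))))
    (Ret ph, i, 0, tp (inc (base ph) u))"
proof -
  obtain p where p: "p \<le> B" "rch w B (Inc ph, i, 1, tp u) [] (Ret ph, i, p, tp (inc (base ph) u))"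
    using rch_inc[of "[]" u B i w ph] assms by auto
  have "rch w B (Ret ph, i, p, tp (inc (base ph) u)) [] (Ret ph, i, 0, tp (inc (base ph) u))"
    by (rule rch_left) (use p assms in auto)
  from reach_trans[OF rch_start[OF assms(1-3)] reach_trans[OF p(2) this]] show ?thesis by simp
qed

lemma base_ge: "2 \<le> base ph" and base_le: "base ph \<le> b ^ 4"
proof -
  have "b ^ 1 \<le> b ^ 4" using b2 by (intro power_increasing) auto
  with b2 show "2 \<le> base ph" "base ph \<le> b ^ 4" unfolding base_def by auto
qed

section \<open>The three phases and the whole run\<close>

lemma length_funpow_inc: "length u \<le> length ((inc \<beta> ^^ j) u)"
  by (induction j) (auto intro: le_trans[OF _ length_inc])

text \<open>Passes precede the increment and the round at \<open>REnd\<close> increments too, so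
  there are \<open>Suc k\<close> increments. The word is then zeroed but keeps its length; this is
  how phase 0 hands on the width.\<close>

lemma rch_input_phase:
  assumes "ph < 2" "i + k = Suc (length w)" "length ((inc (base ph) ^^ Suc k) u) < B" "set u \<subseteq> {..<base ph}"
  shows "rch w B (Start ph, i, 0, tp u)
     (concat (map (\<lambda>j. concat (map (pass_out ((inc (base ph) ^^ j) u)) (pl ph (input_sym w (i + j))))) [0..<Suc k]))
     (Start (Suc ph), 0, 0, tp (replicate (length ((inc (base ph) ^^ Suc k) u)) 0))"
  using assms(2-4)
proof (induction k arbitrary: i u)
  case 0
  let ?u = "inc (base ph) u"
  have sub: "{..<base ph} \<subseteq> {..<b ^ 4}" using base_le by simp
  have u: "set u \<subseteq> {..<b ^ 4}" "set ?u \<subseteq> {..<b ^ 4}"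
    using subset_trans[OF _ sub] 0(3) set_inc[OF base_ge 0(3)] by blast+
  have len: "length u < B" "length ?u < B" using 0 length_inc[of u "base ph"] by auto
  have i: "i \<le> Suc (length w)" "input_sym w i = REnd" using 0 by (auto simp: input_sym_def)
  have 1: "rch w B (Ret ph, i, 0, tp ?u) [] (Clr (Suc ph), i, 1, tp ?u)"
    by (rule rch_step[OF _ _ _ reach_refl]) (use i len assms(1) in \<open>auto simp: fun_upd_idem\<close>)
  have 2: "rch w B (Clr (Suc ph), i, 1, tp ?u) [] (Rew (Suc ph), i, length ?u, tp (replicate (length ?u) 0))"
    using rch_clr[of "[]" ?u B i w "Suc ph"] i len by simp
  have 3: "rch w B (Rew (Suc ph), i, length ?u, tp (replicate (length ?u) 0)) []
      (Rew (Suc ph), i, 0, tp (replicate (length ?u) 0))"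
    by (rule rch_left) (use i len b2 in auto)
  note 4 = rch_rew[OF i(1), of B "Suc ph" "replicate (length ?u) 0"]
  have 5: "rch w B (Start ph, i, 0, tp u) (concat (map (pass_out u) (pl ph (input_sym w i)))) (Ret ph, i, 0, tp ?u)"
    by (rule rch_round) (use u len i assms(1) in auto)
  from reach_trans[OF 5 reach_trans[OF 1 reach_trans[OF 2 reach_trans[OF 3 4]]]] show ?case by simp
next
  case (Suc k)
  let ?u = "inc (base ph) u"
  have sub: "{..<base ph} \<subseteq> {..<b ^ 4}" using base_le by simp
  have u: "set u \<subseteq> {..<b ^ 4}" "set ?u \<subseteq> {..<b ^ 4}" "set ?u \<subseteq> {..<base ph}"
    using subset_trans[OF _ sub] Suc.prems(3) set_inc[OF base_ge Suc.prems(3)] by blast+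
  have fp: "(inc (base ph) ^^ Suc j) u = (inc (base ph) ^^ j) ?u" for j
    by (simp add: funpow_swap1)
  have "length u \<le> length ((inc (base ph) ^^ Suc (Suc k)) u)" by (rule length_funpow_inc)
  then have len: "length u < B" using Suc.prems(2) by simp
  have i: "i \<le> length w" "input_sym w i \<noteq> REnd" using Suc by (auto simp: input_sym_def)
  have 1: "rch w B (Start ph, i, 0, tp u) (concat (map (pass_out u) (pl ph (input_sym w i)))) (Ret ph, i, 0, tp ?u)"
    by (rule rch_round) (use u len i assms(1) in auto)
  have 2: "rch w B (Ret ph, i, 0, tp ?u) [] (Start ph, Suc i, 0, tp ?u)"
    by (rule rch_step[OF _ _ _ reach_refl]) (use i assms(1) in \<open>auto simp: fun_upd_idem\<close>)
  have 3: "rch w B (Start ph, Suc i, 0, tp ?u)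
     (concat (map (\<lambda>j. concat (map (pass_out ((inc (base ph) ^^ j) ?u)) (pl ph (input_sym w (Suc i + j))))) [0..<Suc k]))
     (Start (Suc ph), 0, 0, tp (replicate (length ((inc (base ph) ^^ Suc k) ?u)) 0))"
    by (rule Suc.IH) (use Suc.prems u(3) in \<open>auto simp: fp simp del: funpow.simps\<close>)
  have upt: "[0..<Suc (Suc k)] = 0 # map Suc [0..<Suc k]"
    by (metis map_Suc_upt upt_conv_Cons zero_less_Suc)
  from reach_trans[OF 1 reach_trans[OF 2 3]] show ?case
    unfolding upt fp by (simp add: fp comp_def del: upt_Suc funpow.simps(2))
qed

text \<open>The induction is on the number of words still to come; the last one is recognised by the
  carry that runs off its end.\<close>

lemma rch_word_phase:
  assumes "j < (b ^ 4) ^ m" "m < B" "i \<le> Suc (length w)"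
  shows "\<exists>p T. rch w B (Start 2, i, 0, tp (digs (b ^ 4) m j))
     (concat (map (\<lambda>j. concat (map (pass_out (digs (b ^ 4) m j)) (pl 2 (input_sym w i)))) [j..<(b ^ 4) ^ m]) @ fin)
     (Acc, i, p, T)"
  using assms(1)
proof (induction "(b ^ 4) ^ m - Suc j" arbitrary: j)
  case 0
  then have j: "Suc j = (b ^ 4) ^ m" by simp
  let ?u = "digs (b ^ 4) m j"
  have B4: "2 \<le> b ^ 4" using base_ge[of 2] by (simp add: base_def)
  have "rch w B (Start 2, i, 0, tp ?u) (concat (map (pass_out ?u) (pl 2 (input_sym w i)))) (Inc 2, i, 1, tp ?u)"
    by (rule rch_start) (use assms b2 set_digs[of "b ^ 4" m j] in auto)
  moreover obtain p T where "rch w B (Inc 2, i, 1, tp ?u) fin (Acc, i, p, T)"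
    using rch_overflow[of "[]" ?u B i w] digs_last[OF B4 j] assms by (auto simp: base_def)
  moreover have "[j..<(b ^ 4) ^ m] = [j]" unfolding j[symmetric] by simp
  ultimately show ?case using reach_trans by fastforce
next
  case (Suc x)
  let ?u = "digs (b ^ 4) m j" and ?v = "digs (b ^ 4) m (Suc j)"
  have B4: "2 \<le> b ^ 4" using base_ge[of 2] by (simp add: base_def)
  have j: "Suc j < (b ^ 4) ^ m" using Suc by simp
  from inc_digs[OF B4 j] have inc: "\<exists>d\<in>set ?u. Suc d < base 2" "inc (base 2) ?u = ?v"
    by (auto simp: base_def)
  have 1: "rch w B (Start 2, i, 0, tp ?u) (concat (map (pass_out ?u) (pl 2 (input_sym w i)))) (Ret 2, i, 0, tp ?v)"
    using rch_round[of ?u B i w 2] inc assms b2 set_digs[of "b ^ 4" m] by auto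
  have 2: "rch w B (Ret 2, i, 0, tp ?v) [] (Start 2, i, 0, tp ?v)"
    by (rule rch_step[OF _ _ _ reach_refl]) (use assms in \<open>auto simp: fun_upd_idem\<close>)
  have "x = (b ^ 4) ^ m - Suc (Suc j)" using Suc.hyps(2) by simp
  from Suc.hyps(1)[OF this j] obtain p T where 3: "rch w B (Start 2, i, 0, tp ?v)
     (concat (map (\<lambda>j. concat (map (pass_out (digs (b ^ 4) m j)) (pl 2 (input_sym w i)))) [Suc j..<(b ^ 4) ^ m]) @ fin)
     (Acc, i, p, T)" by blast
  have "[j..<(b ^ 4) ^ m] = j # [Suc j..<(b ^ 4) ^ m]" using j by (intro upt_conv_Cons) simp
  with reach_trans[OF 1 reach_trans[OF 2 3]] show ?case by auto
qed

text \<open>The input has \<open>length w + 2\<close> positions, counting the two end markers.\<close>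

definition width :: "bool list \<Rightarrow> nat" where
  "width w = length ((inc 2 ^^ (length w + 2)) [])"

text \<open>The lower bound makes words wide enough for all input positions and, for suitable
  \<open>b\<close>, for the running time; the upper bound gives logarithmic space.\<close>

lemma width_bounds: "length w + 2 < 2 ^ width w" "2 ^ width w \<le> 2 * (length w + 2) + 1"
  using count2[of "length w + 2"] num2_less[of "(inc 2 ^^ (length w + 2)) []"]
  unfolding width_def by auto

definition printed :: "bool list \<Rightarrow> bool list" where
  "printed w =
     concat (map (\<lambda>j. concat (map (pass_out (digs b (width w) j)) (pl 1 (input_sym w j)))) [0..<length w + 2])
   @ concat (map (\<lambda>j. concat (map (pass_out (digs (b ^ 4) (width w) j)) (pl 2 LEnd))) [0..<(b ^ 4) ^ width w]) @ fin"

lemma funpow_inc_digs: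
  assumes "j < b ^ m"
  shows "(inc b ^^ j) (replicate m 0) = digs b m j"
  using assms inc_digs[OF b2] by (induction j) (auto simp: digs_0)

lemma rch_total: "\<exists>i p T. rch w (Suc (width w)) (Boot, 0, 0, \<lambda>_. 0) (printed w) (Acc, i, p, T)"
proof -
  let ?B = "Suc (width w)" and ?m = "width w"
  \<comment> \<open>Counting the positions in base \<open>b\<close> therefore never lengthens the
    word.\<close>
  have N: "length w + 2 < b ^ ?m"
    using width_bounds(1)[of w] power_mono[OF b2, of ?m] by linarith
  have s1: "rch w ?B (Boot, 0, 0, \<lambda>_. 0) [] (Start 0, 0, 0, tp [])"
    by (rule rch_step[OF _ _ _ reach_refl]) (auto simp: tp_def fun_eq_iff)
  have s2: "rch w ?B (Start 0, 0, 0, tp []) [] (Start 1, 0, 0, tp (replicate ?m 0))"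
    using rch_input_phase[of 0 0 "Suc (length w)" w "[]" ?B] by (simp add: base_def pl0 width_def map_replicate_const)
  have s3: "rch w ?B (Start 1, 0, 0, tp (replicate ?m 0))
     (concat (map (\<lambda>j. concat (map (pass_out (digs b ?m j)) (pl 1 (input_sym w j)))) [0..<length w + 2]))
     (Start 2, 0, 0, tp (replicate ?m 0))"
  proof -
    have 1: "(inc b ^^ j) (replicate ?m 0) = digs b ?m j" if "j \<le> length w + 2" for j
      by (rule funpow_inc_digs) (use that N in simp)
    have eq: "map (\<lambda>j. concat (map (pass_out ((inc b ^^ j) (replicate ?m 0))) (pl 1 (input_sym w j)))) [0..<length w + 2]
       = map (\<lambda>j. concat (map (pass_out (digs b ?m j)) (pl 1 (input_sym w j)))) [0..<length w + 2]"
      by (intro map_cong refl) (subst 1, auto)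
    have len: "length ((inc b ^^ (length w + 2)) (replicate ?m 0)) = ?m"
      by (simp only: 1[OF order.refl] length_digs)
    have "set (replicate ?m 0) \<subseteq> {..<base 1}" using base_ge[of 1] by auto
    with rch_input_phase[of 1 0 "Suc (length w)" w "replicate ?m 0" ?B] len
    have "rch w ?B (Start 1, 0, 0, tp (replicate ?m 0))
      (concat (map (\<lambda>j. concat (map (pass_out ((inc b ^^ j) (replicate ?m 0))) (pl 1 (input_sym w j)))) [0..<length w + 2]))
      (Start 2, 0, 0, tp (replicate (length ((inc b ^^ (length w + 2)) (replicate ?m 0))) 0))"
      by (simp add: base_def numeral_2_eq_2 del: funpow.simps upt_Suc)
    then show ?thesis unfolding eq len .
  qed
  obtain p T where s4: "rch w ?B (Start 2, 0, 0, tp (replicate ?m 0))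
     (concat (map (\<lambda>j. concat (map (pass_out (digs (b ^ 4) ?m j)) (pl 2 LEnd))) [0..<(b ^ 4) ^ ?m]) @ fin) (Acc, 0, p, T)"
    using rch_word_phase[of 0 ?m ?B 0 w] b2 by (auto simp: digs_0 input_sym_def)
  from reach_trans[OF s1 reach_trans[OF s2 reach_trans[OF s3 s4]]] show ?thesis
    unfolding printed_def by auto
qed

lemma logspace_printed: "\<exists>M. logspace_computes M printed"
proof (rule logspace_computes_word[where Q = Q and Y = "{..mark}" and \<delta> = \<delta> and k = 4
      and B = "\<lambda>w. Suc (width w)" and qs = Boot and qa = Acc and qr = Rej])
  fix w :: "bool list"
  let ?n = "real (length w + 2)"
  have "real (2 ^ width w) \<le> real (2 * (length w + 2) + 1)"
    using width_bounds(2)[of w] by (simp only: of_nat_le_iff)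
  then have "real (2 ^ width w) \<le> 2 ^ 2 * ?n" by simp
  then have "log 2 (real (2 ^ width w)) \<le> log 2 (2 ^ 2 * ?n)"
    by (subst log_le_cancel_iff) simp_all
  also have "log 2 (2 ^ 2 * ?n) = 2 + log 2 ?n"
    using log_nat_power[of 2 2 2] by (subst log_mult) auto
  finally have "real (width w) \<le> 2 + log 2 ?n" by simp
  \<comment> \<open>The factor 4 arises here: the additive 3 in the bound for
    \<open>width w + 1\<close> is absorbed by \<open>3 * log 2 ?n\<close>.\<close>
  moreover have "1 \<le> log 2 ?n" by simp
  ultimately have "real (width w) + 1 \<le> 4 * log 2 ?n" by linarith
  then show "real (Suc (width w)) \<le> real 4 * log 2 ?n" by simp
next
  show "{Boot, Acc, Rej} \<subseteq> Q" by (simp add: Q_def)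
next
  fix q a s q' s' mi mw v assume "q \<in> Q" "s \<in> {..mark}" "\<delta> q a s = (q', s', mi, mw, v)"
  then show "q' \<in> Q \<and> s' \<in> {..mark}" by (rule \<delta>_closed)
next
  fix w
  show "\<exists>i p T. reach \<delta> {Acc, Rej} w (Suc (width w)) (Boot, 0, 0, \<lambda>_. 0) (printed w) (Acc, i, p, T)"
    by (rule rch_total)
qed (simp_all add: finite_Q)

end

subsection \<open>Codes of nodes\<close>

text \<open>Digits of the components are interleaved, as a single pass over the tape meets them. The
  quotients left after \<open>m\<close> digits are printed as well, since a successor may reach
  \<open>b ^ m\<close>.\<close>

fun node_digits :: "nat \<Rightarrow> nat \<Rightarrow> nat list \<Rightarrow> bool list" where
  "node_digits b 0 xs = concat (map unary xs)"
| "node_digits b (Suc m) xs = concat (map unary (map (\<lambda>x. x mod b) xs)) @ node_digits b m (map (\<lambda>x. x div b) xs)"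

fun isym_code :: "isym \<Rightarrow> nat" where
  "isym_code LEnd = 0"
| "isym_code REnd = 1"
| "isym_code (Bit c) = (if c then 2 else 3)"

text \<open>Two numbers for every node but the root, so that equal codes split at the same place.
  The root has none and thereby gets the code 1 that the dependency demands.\<close>

fun tags :: "'f node \<Rightarrow> nat list" where
  "tags (NS q t i p) = [0, q]"
| "tags (NW s t p) = [1, s]"
| "tags (NI a i) = [2, isym_code a]"
| "tags (NLt x y) = [3, 0]"
| "tags NTrue = [4, 0]"
| "tags NRoot = []"

fun node_fields :: "'f node \<Rightarrow> 'f list" where
  "node_fields (NS q t i p) = [t, i, p]"
| "node_fields (NW s t p) = [t, p]"
| "node_fields (NI a i) = [i]"
| "node_fields (NLt x y) = [x, y]"
| "node_fields NTrue = []"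
| "node_fields NRoot = []"

definition node_code :: "nat \<Rightarrow> nat \<Rightarrow> nat node \<Rightarrow> nat" where
  "node_code b m n = bits_nat (concat (map unary (tags n)) @ node_digits b m (node_fields n))"

lemma fields_map: "node_fields (map_node f n) = map f (node_fields n)"
  by (cases n) auto

lemma tags_map: "tags (map_node f n) = tags n"
  by (cases n) auto

lemma set_fields: "set (node_fields n) = set_node n"
  by (cases n) auto

lemma length_node_fields: "length (node_fields n) \<le> 3"
  by (cases n) auto

lemma node_digits_Nil [simp]: "node_digits b m [] = []"
  by (induction m) auto

lemma unary_inj: "unary x @ r = unary y @ r' \<Longrightarrow> x = y \<and> r = r'"
proof (induction x arbitrary: y)
  case 0
  then show ?case by (cases y) (auto simp: unary_def)
next
  case (Suc x)
  then show ?case by (cases y) (auto simp: unary_def)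
qed

lemma concat_unary_inj:
  "length xs = length ys \<Longrightarrow> concat (map unary xs) @ r = concat (map unary ys) @ r' \<Longrightarrow> xs = ys \<and> r = r'"
proof (induction xs ys rule: list_induct2)
  case (Cons x xs y ys)
  then have "unary x @ (concat (map unary xs) @ r) = unary y @ (concat (map unary ys) @ r')" by simp
  from unary_inj[OF this] Cons.IH show ?case by simp
qed simp

lemma node_digits_inj:
  "length xs = length ys \<Longrightarrow> node_digits b m xs = node_digits b m ys \<Longrightarrow> xs = ys"
proof (induction m arbitrary: xs ys)
  case 0
  then show ?case using concat_unary_inj[of xs ys "[]" "[]"] by simp
next
  case (Suc m)
  from concat_unary_inj[OF _ Suc.prems(2)[unfolded node_digits.simps]] Suc.prems(1)
  have m: "map (\<lambda>x. x mod b) xs = map (\<lambda>x. x mod b) ys"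
    and d: "node_digits b m (map (\<lambda>x. x div b) xs) = node_digits b m (map (\<lambda>x. x div b) ys)" by auto
  from Suc.IH[OF _ d] Suc.prems(1) have d: "map (\<lambda>x. x div b) xs = map (\<lambda>x. x div b) ys" by simp
  show ?case
  proof (rule nth_equalityI)
    fix i assume "i < length xs"
    with m d Suc.prems(1) have "xs ! i mod b = ys ! i mod b" "xs ! i div b = ys ! i div b"
      by (metis nth_map)+
    then show "xs ! i = ys ! i" by (metis div_mult_mod_eq)
  qed (rule Suc.prems(1))
qed

lemma isym_code_inj: "isym_code a = isym_code a' \<Longrightarrow> a = a'"
  by (cases a; cases a') (auto split: if_splits)

lemma inj_node_code: "inj (node_code b m)"
proof (rule injI)
  fix n n' assume "node_code b m n = node_code b m n'"
  then have e: "concat (map unary (tags n)) @ node_digits b m (node_fields n) =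
      concat (map unary (tags n')) @ node_digits b m (node_fields n')"
    using inj_bits_nat unfolding node_code_def by (meson injD)
  have len: "length (tags k) = 2" if "k \<noteq> NRoot" for k :: "nat node"
    using that by (cases k) auto
  have ne: "concat (map unary (tags k)) = [] \<longrightarrow> k = NRoot" for k :: "nat node"
    by (cases k) (auto simp: unary_def)
  show "n = n'"
  proof (cases "n = NRoot \<or> n' = NRoot")
    case True
    then show ?thesis using e ne[of n] ne[of n'] by auto
  next
    case False
    with concat_unary_inj[OF _ e] len have t: "tags n = tags n'" and
      d: "node_digits b m (node_fields n) = node_digits b m (node_fields n')" by auto
    \<comment> \<open>Equal tags force equal constructors and hence equally many fields, as
      \<open>node_digits_inj\<close> requires.\<close>
    from t have "length (node_fields n) = length (node_fields n')" by (cases n; cases n'; simp)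
    with node_digits_inj d have "node_fields n = node_fields n'" by blast
    with t isym_code_inj show ?thesis by (cases n; cases n'; simp)
  qed
qed

lemma node_code_NRoot: "node_code b m NRoot = 1"
  by (simp add: node_code_def)

subsection \<open>Printing the rules\<close>

definition toks :: "tok list \<Rightarrow> bool list" where
  "toks ts = concat (map tok_bits ts)"

lemma toks_Cons: "toks (t # ts) = tok_bits t @ toks ts"
  by (simp add: toks_def)

lemma toks_append [simp]: "toks (xs @ ys) = toks xs @ toks ys"
  by (simp add: toks_def)

text \<open>The closing \<open>T1\<close> is the top bit contributed by
  \<open>bits_nat\<close>.\<close>

definition node_pass :: "field node \<Rightarrow> pass" where
  "node_pass n = (toks [TSep] @ bits_out (concat (map unary (tags n))), node_fields n, toks [T1])"

text \<open>\<open>bin 0\<close> is empty, so the header of an \<open>Rl\<close> fact is just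
  \<open>TSep # bin 4\<close>. Passes without fields print fixed words.\<close>

definition rule_passes :: "field node list \<Rightarrow> pass list" where
  "rule_passes \<rho> = (toks (TSep # bin 4), [], []) # map node_pass \<rho> @ [(toks [TEnd], [], [])]"

section \<open>Numbers held on the tracks of a word\<close>

context enumerator
begin

fun val :: "nat \<Rightarrow> nat list \<Rightarrow> nat" where
  "val r [] = 0"
| "val r (d # u) = dig r d + b * val r u"

text \<open>Schoolbook addition of a small number: remainder and quotient of
  \<open>dig r d + c\<close> by \<open>b\<close> are the printed digit and the next carry, and the
  final carry is the leftover quotient in \<open>node_digits\<close>.\<close>

lemma read_out_eq: "read_out fs u = node_digits b (length u) (map (\<lambda>(r, c). val r u + c) fs)"
proof (induction u arbitrary: fs)
  case Nil
  have "unary \<circ> (\<lambda>(r :: nat, c). c) = (\<lambda>(r, c). unary c)" by auto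
  then show ?case by simp
next
  case (Cons d u)
  have b: "0 < b" using b2 by simp
  have e: "dig r d + b * val r u + c = (dig r d + c) + b * val r u" for r c by simp
  have fo: "field_out d = (\<lambda>f. unary ((case f of (r, c) \<Rightarrow> val r (d # u) + c) mod b))"
    by (rule ext, rename_tac f, case_tac f) (simp only: field_out_def prod.case val.simps e mod_mult_self2)
  have dv: "(dig r d + b * val r u + c) div b = val r u + (dig r d + c) div b" for r c
    unfolding e using b by (intro div_mult_self2) simp
  have ad: "(case adv d f of (r, c) \<Rightarrow> val r u + c) = (case f of (r, c) \<Rightarrow> val r (d # u) + c) div b" for f
    by (cases f) (simp only: adv_def prod.case val.simps dv)
  show ?case
    by (simp only: read_out.simps length_Cons node_digits.simps Cons.IH fo map_map comp_def ad)
qed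

definition val_node :: "nat list \<Rightarrow> field node \<Rightarrow> nat node" where
  "val_node u = map_node (\<lambda>(r, c). val r u + c)"

lemma toks_bit_tok: "toks (map bit_tok bs) = bits_out bs"
  by (simp add: toks_def bits_out_def comp_def)

lemma pass_out_node_pass:
  "pass_out u (node_pass n) = toks (TSep # bin (node_code b (length u) (val_node u n)))"
proof -
  have "toks (TSep # bin (node_code b (length u) (val_node u n))) =
    toks ([TSep] @ map bit_tok (concat (map unary (tags n))) @
      map bit_tok (node_digits b (length u) (map (\<lambda>(r, c). val r u + c) (node_fields n))) @ [T1])"
    by (simp add: node_code_def bin_bits_nat val_node_def tags_map fields_map)
  also have "\<dots> = pass_out u (node_pass n)"
    unfolding toks_append toks_bit_tok by (simp add: pass_out_def node_pass_def read_out_eq)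
  finally show ?thesis by simp
qed

lemma bits_out_Nil: "bits_out [] = []"
  by (simp add: bits_out_def)

lemma pass_out_rule_passes:
  "concat (map (pass_out u) (rule_passes \<rho>)) =
     toks (enc_fact (Rl, map (node_code b (length u) \<circ> val_node u) \<rho>))"
proof -
  have "concat (map (pass_out u) (map node_pass \<rho>)) =
      toks (concat (map (\<lambda>c. TSep # bin c) (map (node_code b (length u) \<circ> val_node u) \<rho>)))"
    by (induction \<rho>) (simp_all add: pass_out_node_pass toks_Cons, simp add: toks_def)
  moreover have "bin 0 = []" by (simp add: bin.simps)
  ultimately show ?thesis
    by (simp add: rule_passes_def pass_out_def read_out_eq bits_out_Nil, simp add: toks_def)
qed

lemma val_less: "val r u < b ^ length u"
proof (induction u)
  case (Cons d u)
  have "dig r d < b" using b2 by (simp add: dig_def)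
  moreover have "b * Suc (val r u) \<le> b * b ^ length u" using Cons by (intro mult_le_mono2) simp
  ultimately show ?case by simp
qed simp

lemma val_4: "set u \<subseteq> {..<b ^ 4} \<Longrightarrow> val 4 u = 0"
  by (induction u) (auto simp: dig_def)

lemma val_0_digs: "j < b ^ m \<Longrightarrow> val 0 (digs b m j) = j"
proof (induction m arbitrary: j)
  case (Suc m)
  have "j div b < b ^ m" using Suc.prems b2 by (simp add: less_mult_imp_div_less mult.commute)
  with Suc.IH show ?case by (simp add: dig_def)
qed simp

lemma dig_pack:
  assumes "a0 < b" "a1 < b" "a2 < b" "a3 < b"
  defines "d \<equiv> a0 + b * (a1 + b * (a2 + b * a3))"
  shows "dig 0 d = a0" "dig 1 d = a1" "dig 2 d = a2" "dig 3 d = a3" "d < b ^ 4"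
proof -
  have b: "0 < b" using b2 by simp
  have 1: "d div b = a1 + b * (a2 + b * a3)" unfolding d_def using assms(1) b by simp
  have 2: "d div b ^ 2 = a2 + b * a3"
    unfolding power2_eq_square div_mult2_eq 1 using assms(2) b by simp
  have 3: "d div b ^ 3 = a3"
    unfolding power3_eq_cube div_mult2_eq 2[unfolded power2_eq_square div_mult2_eq] using assms(3) b by simp
  show "dig 0 d = a0" "dig 1 d = a1" "dig 2 d = a2" "dig 3 d = a3"
    unfolding dig_def using assms 1 2 3 by (simp_all add: d_def)
  have lt: "x + b * y < b * N" if "x < b" "y < N" for x y N :: nat
  proof -
    have "b * Suc y \<le> b * N" using that(2) by (intro mult_le_mono2) simp
    with that(1) show ?thesis by simp
  qed
  have "d < b * (b * (b * b))" unfolding d_def using assms by (intro lt)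
  then show "d < b ^ 4" by (simp add: power4_eq_xxxx mult.assoc)
qed

text \<open>The four expansions are packed digit by digit. Enumerating the words of length
  \<open>m\<close> thus enumerates all quadruples of numbers below \<open>b ^ m\<close>.\<close>

lemma val_surj:
  assumes "i < b ^ m" "t < b ^ m" "p < b ^ m" "x < b ^ m"
  shows "\<exists>v. length v = m \<and> set v \<subseteq> {..<b ^ 4} \<and> val 0 v = i \<and> val 1 v = t \<and> val 2 v = p \<and> val 3 v = x"
  using assms
proof (induction m arbitrary: i t p x)
  case 0
  then show ?case by auto
next
  case (Suc m)
  have dv: "y div b < b ^ m" if "y < b ^ Suc m" for y
    using that b2 by (simp add: less_mult_imp_div_less mult.commute)
  from Suc.IH[OF Suc.prems[THEN dv]] obtain v where v: "length v = m" "set v \<subseteq> {..<b ^ 4}"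
    "val 0 v = i div b" "val 1 v = t div b" "val 2 v = p div b" "val 3 v = x div b" by blast
  define d where "d = i mod b + b * (t mod b + b * (p mod b + b * (x mod b)))"
  have "dig 0 d = i mod b" "dig 1 d = t mod b" "dig 2 d = p mod b" "dig 3 d = x mod b" "d < b ^ 4"
    unfolding d_def using dig_pack[of "i mod b" "t mod b" "p mod b" "x mod b"] b2 by simp_all
  with v show ?case by (intro exI[of _ "d # v"]) simp
qed

end

section \<open>The reduction and its correctness\<close>

lemma templates_fields:
  assumes "\<rho> \<in> templates M" "n \<in> set \<rho>"
  shows "set (node_fields n) \<subseteq> {..4} \<times> {..1}"
proof -
  have i: "fst (imove mi a) \<in> {..4} \<times> {..1}" "snd (imove mi a) \<in> {..4} \<times> {..1}" for mi a
    by (cases mi; simp)+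
  have p: "pmove mw \<subseteq> ({..4} \<times> {..1}) \<times> ({..4} \<times> {..1})" for mw
    by (cases mw) auto
  have "set \<rho> \<subseteq> {n. set (node_fields n) \<subseteq> {..4} \<times> {..1}}"
  proof (cases "\<exists>q s a. \<rho> \<in> step_templates M q a s")
    case True
    then obtain q s a q' s' mi mw where
      "\<rho> = [NW s' fT' fP, NS q fT fI fP, NW s fT fP, NI a fI] \<or>
      (\<exists>(pb, ph)\<in>pmove mw. \<rho> = [NS q' fT' (snd (imove mi a)) ph, NS q fT (fst (imove mi a)) pb,
           NW s fT pb, NI a (fst (imove mi a))])"
      unfolding step_templates_iff by blast
    then show ?thesis
    proof
      assume "\<exists>(pb, ph)\<in>pmove mw. \<rho> = [NS q' fT' (snd (imove mi a)) ph, NS q fT (fst (imove mi a)) pb,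
           NW s fT pb, NI a (fst (imove mi a))]"
      then obtain pb ph where "(pb, ph) \<in> pmove mw" and r: "\<rho> = [NS q' fT' (snd (imove mi a)) ph,
           NS q fT (fst (imove mi a)) pb, NW s fT pb, NI a (fst (imove mi a))]" by blast
      with p have "pb \<in> {..4} \<times> {..1}" "ph \<in> {..4} \<times> {..1}" by blast+
      with i[of mi a] show ?thesis unfolding r by simp
    qed simp
  next
    case False
    with assms(1) show ?thesis unfolding templates_def by auto
  qed
  with assms(2) show ?thesis by blast
qed

lemma finite_templates:
  assumes "wf_tm M"
  shows "finite (templates M)"
proof -
  have "finite (pmove mw)" for mw by (cases mw) auto
  then have "finite (step_templates M q a s)" for q a s
    unfolding step_templates_def by (auto split: prod.splits)
  with assms finite_UNIV_isym show ?thesis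
    unfolding templates_def wf_tm_def by simp
qed

text \<open>Phase 1 visits each input position while its number is on the tape, so the input facts
  are printed there; all other rules are independent of the input symbols.\<close>

definition rule_pl :: "field node list list \<Rightarrow> nat \<Rightarrow> isym \<Rightarrow> pass list" where
  "rule_pl rs ph a = (if ph = 0 then [] else if ph = 1 then rule_passes [NI a fI, NTrue, NTrue, NTrue]
     else concat (map rule_passes rs))"

lemma reduction:
  assumes wf: "wf_tm M" and b2: "2 \<le> b"
  shows "\<exists>M' f. logspace_computes M' f \<and> (\<forall>w. \<exists>fs m. f w = enc_pair fs [] \<and> length w + 2 < 2 ^ m \<and>
    set fs = (\<lambda>r. (Rl, map (node_code b m) r)) ` rules M w (b ^ m))"
proof -
  obtain rs where rs: "set rs = templates M" using finite_list[OF finite_templates[OF wf]] by blast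
  have ok: "set fs \<subseteq> {..4} \<times> {..1} \<and> length fs \<le> 3" if "(pre, fs, post) \<in> set (rule_pl rs ph a)" for pre fs post ph a
  proof -
    from that consider "fs = []" | "fs = [fI]"
      | n \<rho> where "fs = node_fields n" "n \<in> set \<rho>" "\<rho> \<in> templates M"
      unfolding rule_pl_def rule_passes_def node_pass_def using rs by (auto split: if_splits)
    then show ?thesis
      by cases (use templates_fields length_node_fields in auto)
  qed
  \<comment> \<open>One \<open>TEnd\<close> closes the first database, the other is the encoding of
    the empty second one.\<close>
  interpret enumerator b "rule_pl rs" "toks [TEnd, TEnd]"
    using b2 ok by unfold_locales (auto simp: rule_pl_def)
  define F1 where "F1 = (\<lambda>w j. (Rl, map (node_code b (width w) \<circ> val_node (digs b (width w) j))
      [NI (input_sym w j) fI, NTrue, NTrue, NTrue]))"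
  define F2 where "F2 = (\<lambda>w j \<rho>. (Rl, map (node_code b (width w) \<circ> val_node (digs (b ^ 4) (width w) j)) \<rho>))"
  define fs where "fs = (\<lambda>w. map (F1 w) [0..<length w + 2] @
      concat (map (\<lambda>j. map (F2 w j) rs) [0..<(b ^ 4) ^ width w]))"
  have "printed w = enc_pair (fs w) []" for w
  proof -
    have cm: "concat (map (\<lambda>j. toks (g j)) xs) = toks (concat (map g xs))" for g :: "'x \<Rightarrow> tok list" and xs
      by (induction xs) (auto simp: toks_def)
    have 1: "concat (map (pass_out (digs b (width w) j)) (rule_pl rs 1 (input_sym w j))) = toks (enc_fact (F1 w j))" for j
      by (simp add: rule_pl_def pass_out_rule_passes F1_def del: enc_fact.simps)
    have 2: "concat (map (pass_out (digs (b ^ 4) (width w) j)) (rule_pl rs 2 LEnd)) =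
        toks (concat (map enc_fact (map (F2 w j) rs)))" for j
    proof -
      have "concat (map (pass_out u) (concat (map rule_passes l))) =
          toks (concat (map enc_fact (map (\<lambda>\<rho>. (Rl, map (node_code b (length u) \<circ> val_node u) \<rho>)) l)))" for u l
        by (induction l) (simp_all add: pass_out_rule_passes toks_def comp_def del: enc_fact.simps)
      then show ?thesis by (simp add: rule_pl_def F2_def del: enc_fact.simps)
    qed
    have "printed w = toks (concat (map (\<lambda>j. enc_fact (F1 w j)) [0..<length w + 2])) @
        toks (concat (map (\<lambda>j. concat (map enc_fact (map (F2 w j) rs))) [0..<(b ^ 4) ^ width w])) @ toks [TEnd, TEnd]"
      unfolding printed_def 1 2 cm ..
    also have "\<dots> = toks (enc_db (fs w) @ enc_db [])"
    proof -
      have "concat (map enc_fact (concat (map g xs))) = concat (map (\<lambda>j. concat (map enc_fact (g j))) xs)"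
        for g :: "nat \<Rightarrow> fact list" and xs
        by (induction xs) simp_all
      then show ?thesis unfolding fs_def enc_db_def by (simp add: toks_Cons comp_def del: enc_fact.simps upt_Suc)
    qed
    finally show ?thesis by (simp add: enc_pair_def toks_def)
  qed
  moreover have "set (fs w) = (\<lambda>r. (Rl, map (node_code b (width w)) r)) ` rules M w (b ^ width w)" for w
  proof -
    let ?m = "width w" and ?c = "\<lambda>r. (Rl, map (node_code b (width w)) r)"
    have N: "length w + 2 < b ^ ?m"
      using width_bounds(1)[of w] power_mono[OF b2, of ?m] by linarith
    have F1: "F1 w j = ?c [NI (input_sym w j) j, NTrue, NTrue, NTrue]" if "j < length w + 2" for j
    proof -
      have "val 0 (digs b ?m j) = j" by (rule val_0_digs) (use that N in simp)
      then show ?thesis by (simp add: F1_def val_node_def)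
    qed
    have inst: "map (val_node v) \<rho> = map (map_node (inst [val 0 v, val 1 v, val 2 v, val 3 v])) \<rho>"
      if "\<rho> \<in> templates M" "set v \<subseteq> {..<b ^ 4}" for v \<rho>
    proof (rule map_cong[OF refl])
      fix n assume "n \<in> set \<rho>"
      show "val_node v n = map_node (inst [val 0 v, val 1 v, val 2 v, val 3 v]) n"
        unfolding val_node_def
      proof (rule node.map_cong0)
        fix f assume "f \<in> set_node n"
        with templates_fields[OF that(1) \<open>n \<in> set \<rho>\<close>] obtain r c where f: "f = (r, c)" "r \<le> 4"
          unfolding set_fields by auto
        from f(2) consider "r = 0" | "r = 1" | "r = 2" | "r = 3" | "r = 4" by linarith
        then show "(case f of (r, c) \<Rightarrow> val r v + c) = inst [val 0 v, val 1 v, val 2 v, val 3 v] f"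
          by cases (simp_all add: f(1) inst_def val_4[OF that(2)])
      qed
    qed
    have F2: "F2 w j \<rho> = ?c (map (val_node (digs (b ^ 4) ?m j)) \<rho>)" for j \<rho>
      by (simp add: F2_def)
    have b4: "0 < b ^ 4" using b2 by simp
    \<comment> \<open>The machine ranges over words, the rules over quadruples of numbers;
      \<open>val_less\<close> and \<open>val_surj\<close> match the two.\<close>
    have "(\<Union>j\<in>{..<(b ^ 4) ^ ?m}. (\<lambda>\<rho>. map (val_node (digs (b ^ 4) ?m j)) \<rho>) ` templates M) =
      {map (map_node (inst [i, t, p, u])) \<rho> | \<rho> i t p u.
         \<rho> \<in> templates M \<and> i < b ^ ?m \<and> t < b ^ ?m \<and> p < b ^ ?m \<and> u < b ^ ?m}" (is "?L = ?R")
    proof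
      show "?L \<subseteq> ?R"
      proof
        fix x assume "x \<in> ?L"
        then obtain j \<rho> where x: "\<rho> \<in> templates M" "x = map (val_node (digs (b ^ 4) ?m j)) \<rho>" by blast
        let ?v = "digs (b ^ 4) ?m j"
        have "x = map (map_node (inst [val 0 ?v, val 1 ?v, val 2 ?v, val 3 ?v])) \<rho>"
          using inst[OF x(1) set_digs[OF b4]] x(2) by simp
        moreover have "val r ?v < b ^ ?m" for r using val_less[of r ?v] by simp
        ultimately show "x \<in> ?R" using x(1) by blast
      qed
      show "?R \<subseteq> ?L"
      proof
        fix x assume "x \<in> ?R"
        then obtain \<rho> i t p u where x: "\<rho> \<in> templates M" "x = map (map_node (inst [i, t, p, u])) \<rho>"
          and l: "i < b ^ ?m" "t < b ^ ?m" "p < b ^ ?m" "u < b ^ ?m" by blast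
        from val_surj[OF l] obtain v where v: "length v = ?m" "set v \<subseteq> {..<b ^ 4}"
          "val 0 v = i" "val 1 v = t" "val 2 v = p" "val 3 v = u" by blast
        from digs_surj[OF v(2)] v(1) obtain j where j: "j < (b ^ 4) ^ ?m" "digs (b ^ 4) ?m j = v" by auto
        have "x = map (val_node v) \<rho>" using inst[OF x(1) v(2)] x(2) v by simp
        with j x(1) show "x \<in> ?L" by blast
      qed
    qed
    moreover have "set (fs w) = ?c ` {[NI (input_sym w i) i, NTrue, NTrue, NTrue] | i. i < length w + 2} \<union>
       ?c ` (\<Union>j\<in>{..<(b ^ 4) ^ ?m}. (\<lambda>\<rho>. map (val_node (digs (b ^ 4) ?m j)) \<rho>) ` templates M)"
    proof -
      have "set (fs w) = F1 w ` {..<length w + 2} \<union> (\<Union>j\<in>{..<(b ^ 4) ^ ?m}. F2 w j ` templates M)"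
        unfolding fs_def by (simp add: rs lessThan_atLeast0 del: upt_Suc)
      moreover have "F1 w ` {..<length w + 2} = ?c ` {[NI (input_sym w i) i, NTrue, NTrue, NTrue] | i. i < length w + 2}"
        using F1 by (force simp: image_iff)
      ultimately show ?thesis unfolding F2 image_UN image_image by simp
    qed
    ultimately show ?thesis unfolding rules_def image_Un by (simp only: Un_commute)
  qed
  ultimately show ?thesis using logspace_printed width_bounds(1) by metis
qed

theorem theorem1:
  shows "\<exists>(S :: pred set) (Sig :: dep set). finite S \<and> Bot \<in> S \<and> finite Sig \<and>
           (\<forall>d\<in>Sig. wf_dep S d) \<and> linear_deps Sig \<and> sticky Sig \<and> ptime_hard (RC S Sig)"
proof (intro exI conjI ballI)
  show "wf_dep {Bot, Rl} d" if "d \<in> {and_or_dep}" for d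
    using that wf_and_or_dep by simp
  show "ptime_hard (RC {Bot, Rl} {and_or_dep})"
    unfolding ptime_hard_def
  proof (intro allI impI)
    fix L assume "L \<in> PTIME"
    then obtain M k where wf: "wf_tm M" and M: "\<And>w. \<exists>n. n \<le> k * (length w + 1) ^ k \<and>
        halted M (run M w n) \<and> (cst (run M w n) = acc M \<longleftrightarrow> w \<in> L)"
      unfolding PTIME_def by blast
    \<comment> \<open>With \<open>length w + 2 < 2 ^ m\<close>, the number \<open>b ^ m\<close> is a
      product of \<open>2 * k + 1\<close> factors \<open>2 ^ m\<close>: \<open>k\<close> of them
      bound the coefficient \<open>k\<close>, another \<open>k\<close> bound
      \<open>(length w + 1) ^ k\<close>, and the last makes the inequality strict.\<close>
    define b :: nat where "b = 2 ^ (2 * k + 1)"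
    have b2: "2 \<le> b" by (simp add: b_def)
    obtain M' f where f: "logspace_computes M' f" and F: "\<And>w. \<exists>fs m. f w = enc_pair fs [] \<and> length w + 2 < 2 ^ m \<and>
        set fs = (\<lambda>r. (Rl, map (node_code b m) r)) ` rules M w (b ^ m)"
      using reduction[OF wf b2] by blast
    have "w \<in> L \<longleftrightarrow> f w \<in> RC {Bot, Rl} {and_or_dep}" for w
    proof -
      obtain fs m where fs: "f w = enc_pair fs []" "length w + 2 < 2 ^ m"
        "set fs = (\<lambda>r. (Rl, map (node_code b m) r)) ` rules M w (b ^ m)" using F by blast
      obtain n where n: "n \<le> k * (length w + 1) ^ k" "halted M (run M w n)" "cst (run M w n) = acc M \<longleftrightarrow> w \<in> L"
        using M by blast
      define X :: nat where "X = (2 ^ m) ^ k * (2 ^ m) ^ k"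
      have bm: "b ^ m = X * 2 ^ m"
        by (simp add: b_def X_def flip: power_mult power_add)
      have "X > 0" by (simp add: X_def)
      have "(2 :: nat) \<le> 2 ^ m" using fs(2) by linarith
      then have "(2 :: nat) ^ k \<le> (2 ^ m) ^ k" by (rule power_mono) simp
      then have "k \<le> (2 ^ m) ^ k" using less_exp[of k] by linarith
      moreover have "(length w + 1) ^ k \<le> (2 ^ m) ^ k" using fs(2) by (intro power_mono) auto
      ultimately have "k * (length w + 1) ^ k \<le> X" unfolding X_def by (rule mult_le_mono)
      also have "X < b ^ m" unfolding bm using \<open>X > 0\<close> \<open>2 \<le> 2 ^ m\<close> by simp
      finally have "n < b ^ m" using n(1) by simp
      moreover have "length w + 1 < b ^ m"
      proof -
        have "1 * 2 ^ m \<le> b ^ m" unfolding bm using \<open>X > 0\<close> by (intro mult_le_mono1) simp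
        with fs(2) show ?thesis by linarith
      qed
      ultimately have "is_repair {and_or_dep} (set fs) {} \<longleftrightarrow> w \<in> L"
        using empty_repair_iff[OF inj_node_code node_code_NRoot fs(3) length_rules]
          post_fixpoint_iff_reject[OF wf _ _ n(2)] n(3) by simp
      moreover have "\<forall>x\<in>set fs. fst x = Rl \<and> length (snd x) = 4"
        unfolding fs(3) using length_rules by auto
      then have db: "is_db {Bot, Rl} (set fs)" "is_db {Bot, Rl} (set [])"
        by (auto simp: is_db_def)
      moreover have "f w \<in> RC {Bot, Rl} {and_or_dep} \<longleftrightarrow> is_repair {and_or_dep} (set fs) (set [])"
      proof
        \<comment> \<open>Membership in \<open>RC\<close> only provides some pair of lists with this
          code; unique decodability identifies it with \<open>fs\<close> and
          \<open>[]\<close>.\<close>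
        assume "f w \<in> RC {Bot, Rl} {and_or_dep}"
        then obtain fs' gs' where "enc_pair fs [] = enc_pair fs' gs'" "is_db {Bot, Rl} (set fs')"
          "is_db {Bot, Rl} (set gs')" "is_repair {and_or_dep} (set fs') (set gs')"
          unfolding RC_def fs(1) by blast
        with enc_pair_inj[OF db] show "is_repair {and_or_dep} (set fs) (set [])" by metis
      next
        assume "is_repair {and_or_dep} (set fs) (set [])"
        with db fs(1) show "f w \<in> RC {Bot, Rl} {and_or_dep}" unfolding RC_def by blast
      qed
      ultimately show ?thesis by simp
    qed
    with f show "logspace_reducible L (RC {Bot, Rl} {and_or_dep})"
      unfolding logspace_reducible_def by blast
  qed
qed (simp_all add: linear_and_or_dep sticky_and_or_dep)

end
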